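(* The Lipschitz MAB problem on a fixed metric space $(X,\mathcal{D})$ is $f(t)$-tractable for some $f\in o(t)$ if and only if the metric completion of $(X,\mathcal{D})$ is a compact metric space.
   Context: Lipschitz MAB problem on a metric space $(X,\mathcal{D})$ (of diameter at most $1$): $(X,\mathcal{D})$ is known to the algorithm. A problem instance $I$ consists of an unknown payoff function $\mu:X\to[0,1]$ with $|\mu(x)-\mu(y)|\le\mathcal{D}(x,y)$ for all $x,y$, and for each $x$ a distribution on $[0,1]$ with mean $\mu(x)$. In each round $t$ the algorithm picks $x_t\in X$ and receives an independent reward from the distribution of $x_t$. Regret: $R(t)=t\sup_x\mu(x)-\mathbb{E}[\sum_{s\le t}\mu(x_s)]$. The problem is $f(t)$-tractable if there is an algorithm such that for every instance $I$ there is a constant $C_I$ with $R(t)\le C_I f(t)$ for all $t$; $f\in o(t)$ means $f(t)/t\to0$. *)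

theory Defs
  imports "HOL-Probability.Probability"
begin

section \<open>Metric completion\<close>

definition cauchy_rel :: "'a set \<Rightarrow> ('a \<Rightarrow> 'a \<Rightarrow> real) \<Rightarrow> ((nat \<Rightarrow> 'a) \<times> (nat \<Rightarrow> 'a)) set" where
  "cauchy_rel X D = {(\<sigma>, \<tau>). Metric_space.MCauchy X D \<sigma> \<and> Metric_space.MCauchy X D \<tau> \<and>
     (\<lambda>n. D (\<sigma> n) (\<tau> n)) \<longlonglongrightarrow> 0}"

definition completion_space :: "'a set \<Rightarrow> ('a \<Rightarrow> 'a \<Rightarrow> real) \<Rightarrow> (nat \<Rightarrow> 'a) set set" where
  "completion_space X D = {\<sigma>. Metric_space.MCauchy X D \<sigma>} // cauchy_rel X D"

text \<open>The value \<open>0\<close> off the carrier is there because the locale \<^locale>\<open>Metric_space\<close> demands a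
  nonnegative symmetric function on the whole type.\<close>

definition completion_dist ::
  "'a set \<Rightarrow> ('a \<Rightarrow> 'a \<Rightarrow> real) \<Rightarrow> (nat \<Rightarrow> 'a) set \<Rightarrow> (nat \<Rightarrow> 'a) set \<Rightarrow> real" where
  "completion_dist X D P Q =
     (if P \<in> completion_space X D \<and> Q \<in> completion_space X D
      then THE r. \<forall>\<sigma>\<in>P. \<forall>\<tau>\<in>Q. (\<lambda>n. D (\<sigma> n) (\<tau> n)) \<longlonglongrightarrow> r else 0)"

context Metric_space
begin

lemma dist_diff_le:
  assumes "a \<in> M" "b \<in> M" "x \<in> M" "y \<in> M"
  shows "\<bar>d a b - d x y\<bar> \<le> d a x + d b y"
  using triangle[of a x b] triangle[of x y b] triangle[of x a y] triangle[of a b y] assms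
    commute[of x a] commute[of y b] by linarith

lemma convergent_dist_MCauchy:
  assumes "MCauchy \<sigma>" "MCauchy \<tau>"
  shows "convergent (\<lambda>n. d (\<sigma> n) (\<tau> n))"
proof (rule Cauchy_convergent, rule metric_CauchyI)
  fix e :: real assume "e > 0"
  then have e: "e/2 > 0" by simp
  obtain N1 where N1: "\<And>n n'. N1 \<le> n \<Longrightarrow> N1 \<le> n' \<Longrightarrow> d (\<sigma> n) (\<sigma> n') < e/2"
    using assms(1) e unfolding MCauchy_def by meson
  obtain N2 where N2: "\<And>n n'. N2 \<le> n \<Longrightarrow> N2 \<le> n' \<Longrightarrow> d (\<tau> n) (\<tau> n') < e/2"
    using assms(2) e unfolding MCauchy_def by meson
  have in_M: "\<sigma> n \<in> M" "\<tau> n \<in> M" for n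
    using assms by (auto simp: MCauchy_def)
  have "dist (d (\<sigma> m) (\<tau> m)) (d (\<sigma> n) (\<tau> n)) < e" if "m \<ge> max N1 N2" "n \<ge> max N1 N2" for m n
    using dist_diff_le[OF in_M in_M, of m m n n] N1[of m n] N2[of m n] that
    by (simp add: dist_real_def)
  then show "\<exists>K. \<forall>m\<ge>K. \<forall>n\<ge>K. dist (d (\<sigma> m) (\<tau> m)) (d (\<sigma> n) (\<tau> n)) < e"
    by blast
qed

lemma LIMSEQ_dist_cauchy_rel:
  assumes "(\<sigma>, \<sigma>') \<in> cauchy_rel M d" "(\<tau>, \<tau>') \<in> cauchy_rel M d"
    and "(\<lambda>n. d (\<sigma> n) (\<tau> n)) \<longlonglongrightarrow> r"
  shows "(\<lambda>n. d (\<sigma>' n) (\<tau>' n)) \<longlonglongrightarrow> r"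
proof -
  have in_M: "\<sigma> n \<in> M" "\<tau> n \<in> M" "\<sigma>' n \<in> M" "\<tau>' n \<in> M" for n
    using assms by (auto simp: cauchy_rel_def MCauchy_def)
  have "(\<lambda>n. d (\<sigma> n) (\<sigma>' n) + d (\<tau> n) (\<tau>' n)) \<longlonglongrightarrow> 0 + 0"
    using assms by (intro tendsto_add) (auto simp: cauchy_rel_def)
  moreover have "\<forall>\<^sub>F n in sequentially. norm (d (\<sigma> n) (\<tau> n) - d (\<sigma>' n) (\<tau>' n))
      \<le> d (\<sigma> n) (\<sigma>' n) + d (\<tau> n) (\<tau>' n)"
    using dist_diff_le[OF in_M(1,2) in_M(3,4)] by simp
  ultimately have "(\<lambda>n. d (\<sigma> n) (\<tau> n) - d (\<sigma>' n) (\<tau>' n)) \<longlonglongrightarrow> 0"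
    by (metis Lim_null_comparison add_0)
  from tendsto_diff[OF assms(3) this] show ?thesis by simp
qed

lemma equiv_cauchy_rel: "equiv {\<sigma>. MCauchy \<sigma>} (cauchy_rel M d)"
proof (rule equivI)
  show "cauchy_rel M d \<subseteq> {\<sigma>. MCauchy \<sigma>} \<times> {\<sigma>. MCauchy \<sigma>}"
    by (auto simp: cauchy_rel_def)
  show "refl_on {\<sigma>. MCauchy \<sigma>} (cauchy_rel M d)"
    by (auto simp: refl_on_def cauchy_rel_def MCauchy_def image_subset_iff)
  show "sym (cauchy_rel M d)"
    by (auto simp: sym_def cauchy_rel_def commute)
  show "trans (cauchy_rel M d)"
  proof (rule transI)
    fix \<rho> \<sigma> \<tau> assume 1: "(\<rho>, \<sigma>) \<in> cauchy_rel M d" and 2: "(\<sigma>, \<tau>) \<in> cauchy_rel M d"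
    then have "(\<rho>, \<rho>) \<in> cauchy_rel M d"
      by (auto simp: cauchy_rel_def MCauchy_def image_subset_iff)
    from LIMSEQ_dist_cauchy_rel[OF this 2] 1 2 show "(\<rho>, \<tau>) \<in> cauchy_rel M d"
      by (auto simp: cauchy_rel_def)
  qed
qed

lemma completion_class_eq:
  "P \<in> completion_space M d \<Longrightarrow> \<sigma> \<in> P \<Longrightarrow> P = cauchy_rel M d `` {\<sigma>}"
  unfolding completion_space_def
  by (erule quotientE) (auto dest: equiv_class_eq[OF equiv_cauchy_rel])

lemma completion_class_MCauchy: "P \<in> completion_space M d \<Longrightarrow> \<sigma> \<in> P \<Longrightarrow> MCauchy \<sigma>"
  unfolding completion_space_def using in_quotient_imp_subset[OF equiv_cauchy_rel] by blast

lemma completion_class_nonempty: "P \<in> completion_space M d \<Longrightarrow> \<exists>\<sigma>. \<sigma> \<in> P"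
  unfolding completion_space_def using in_quotient_imp_non_empty[OF equiv_cauchy_rel] by blast

lemma cauchy_class_in: "MCauchy \<sigma> \<Longrightarrow> cauchy_rel M d `` {\<sigma>} \<in> completion_space M d"
  by (simp add: completion_space_def quotientI)

lemma self_in_cauchy_class: "MCauchy \<sigma> \<Longrightarrow> \<sigma> \<in> cauchy_rel M d `` {\<sigma>}"
  using equiv_class_self[OF equiv_cauchy_rel] by simp

lemma completion_dist_lim:
  assumes P: "P \<in> completion_space M d" and Q: "Q \<in> completion_space M d" and "\<sigma> \<in> P" "\<tau> \<in> Q"
  shows "(\<lambda>n. d (\<sigma> n) (\<tau> n)) \<longlonglongrightarrow> completion_dist M d P Q"
proof -
  obtain r where r: "(\<lambda>n. d (\<sigma> n) (\<tau> n)) \<longlonglongrightarrow> r"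
    using convergent_dist_MCauchy[of \<sigma> \<tau>] completion_class_MCauchy assms
    by (auto simp: convergent_def)
  have *: "\<forall>\<sigma>'\<in>P. \<forall>\<tau>'\<in>Q. (\<lambda>n. d (\<sigma>' n) (\<tau>' n)) \<longlonglongrightarrow> r"
    using LIMSEQ_dist_cauchy_rel[OF _ _ r] completion_class_eq[OF P \<open>\<sigma> \<in> P\<close>]
      completion_class_eq[OF Q \<open>\<tau> \<in> Q\<close>] by blast
  have "(THE r. \<forall>\<sigma>\<in>P. \<forall>\<tau>\<in>Q. (\<lambda>n. d (\<sigma> n) (\<tau> n)) \<longlonglongrightarrow> r) = r"
    proof (rule the_equality)
    show "\<forall>\<sigma>\<in>P. \<forall>\<tau>\<in>Q. (\<lambda>n. d (\<sigma> n) (\<tau> n)) \<longlonglongrightarrow> r" using * .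
  next
    fix r' assume "\<forall>\<sigma>\<in>P. \<forall>\<tau>\<in>Q. (\<lambda>n. d (\<sigma> n) (\<tau> n)) \<longlonglongrightarrow> r'"
    then show "r' = r" using LIMSEQ_unique[OF _ r] assms(3,4) by blast
  qed
  with r P Q show ?thesis by (simp add: completion_dist_def)
qed

lemma Metric_space_completion: "Metric_space (completion_space M d) (completion_dist M d)"
proof
  fix P Q
  have carrier: "0 \<le> completion_dist M d P Q \<and> completion_dist M d P Q = completion_dist M d Q P"
    if PQ: "P \<in> completion_space M d" "Q \<in> completion_space M d"
  proof -
    obtain \<sigma> \<tau> where st: "\<sigma> \<in> P" "\<tau> \<in> Q" using PQ completion_class_nonempty by meson
    have l: "(\<lambda>n. d (\<sigma> n) (\<tau> n)) \<longlonglongrightarrow> completion_dist M d P Q"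
      "(\<lambda>n. d (\<sigma> n) (\<tau> n)) \<longlonglongrightarrow> completion_dist M d Q P"
      using completion_dist_lim[OF PQ st] completion_dist_lim[OF PQ(2,1) st(2,1)]
      by (simp_all add: commute)
    show ?thesis
      using LIMSEQ_unique[OF l] LIMSEQ_le_const[OF l(1), of 0] by simp
  qed
  then show "0 \<le> completion_dist M d P Q"
    by (cases "P \<in> completion_space M d \<and> Q \<in> completion_space M d") (auto simp: completion_dist_def)
  from carrier show "completion_dist M d P Q = completion_dist M d Q P"
    by (cases "P \<in> completion_space M d \<and> Q \<in> completion_space M d") (auto simp: completion_dist_def)
next
  fix P Q assume PQ: "P \<in> completion_space M d" "Q \<in> completion_space M d"
  obtain \<sigma> \<tau> where st: "\<sigma> \<in> P" "\<tau> \<in> Q" using PQ completion_class_nonempty by meson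
  note l = completion_dist_lim[OF PQ st]
  have c: "MCauchy \<sigma>" "MCauchy \<tau>" using completion_class_MCauchy PQ st by auto
  show "completion_dist M d P Q = 0 \<longleftrightarrow> P = Q"
  proof
    assume "completion_dist M d P Q = 0"
    then have "(\<sigma>, \<tau>) \<in> cauchy_rel M d" using l c by (simp add: cauchy_rel_def)
    then show "P = Q"
      using completion_class_eq PQ st equiv_class_eq[OF equiv_cauchy_rel] by metis
  next
    assume "P = Q"
    then have "(\<lambda>n. d (\<sigma> n) (\<sigma> n)) \<longlonglongrightarrow> completion_dist M d P Q"
      using completion_dist_lim[OF PQ] st by simp
    moreover have "d (\<sigma> n) (\<sigma> n) = 0" for n
      using c by (auto simp: MCauchy_def image_subset_iff)
    ultimately show "completion_dist M d P Q = 0" by (simp add: LIMSEQ_const_iff)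
  qed
next
  fix P Q R
  assume PQR: "P \<in> completion_space M d" "Q \<in> completion_space M d" "R \<in> completion_space M d"
  obtain \<rho> \<sigma> \<tau> where st: "\<rho> \<in> P" "\<sigma> \<in> Q" "\<tau> \<in> R" using PQR completion_class_nonempty by meson
  have in_M: "\<rho> n \<in> M" "\<sigma> n \<in> M" "\<tau> n \<in> M" for n
    using completion_class_MCauchy PQR st by (auto simp: MCauchy_def image_subset_iff)
  show "completion_dist M d P R \<le> completion_dist M d P Q + completion_dist M d Q R"
    using LIMSEQ_le[OF completion_dist_lim[OF PQR(1,3) st(1,3)]
        tendsto_add[OF completion_dist_lim[OF PQR(1,2) st(1,2)] completion_dist_lim[OF PQR(2,3) st(2,3)]]]
      triangle[OF in_M] by blast
qed

definition completion_embed :: "'a \<Rightarrow> (nat \<Rightarrow> 'a) set" where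
  "completion_embed x = cauchy_rel M d `` {\<lambda>_. x}"

lemma completion_embed_in: "x \<in> M \<Longrightarrow> completion_embed x \<in> completion_space M d"
  by (simp add: completion_embed_def cauchy_class_in)

lemma const_in_completion_embed: "x \<in> M \<Longrightarrow> (\<lambda>_. x) \<in> completion_embed x"
  unfolding completion_embed_def by (rule self_in_cauchy_class) simp

lemma completion_dist_embed:
  "x \<in> M \<Longrightarrow> y \<in> M \<Longrightarrow> completion_dist M d (completion_embed x) (completion_embed y) = d x y"
  using completion_dist_lim[OF completion_embed_in completion_embed_in const_in_completion_embed
      const_in_completion_embed, of x y] by (simp add: LIMSEQ_const_iff)

lemma completion_dist_embed_seq:
  assumes \<sigma>: "MCauchy \<sigma>"
  shows "(\<lambda>n. completion_dist M d (completion_embed (\<sigma> n)) (cauchy_rel M d `` {\<sigma>})) \<longlonglongrightarrow> 0"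
proof (rule LIMSEQ_I)
  fix e :: real assume "e > 0"
  then obtain N where N: "\<And>n n'. N \<le> n \<Longrightarrow> N \<le> n' \<Longrightarrow> d (\<sigma> n) (\<sigma> n') < e/2"
    using \<sigma> unfolding MCauchy_def by (meson half_gt_zero)
  interpret C: Metric_space "completion_space M d" "completion_dist M d"
    by (rule Metric_space_completion)
  have "completion_dist M d (completion_embed (\<sigma> n)) (cauchy_rel M d `` {\<sigma>}) \<le> e/2" if "n \<ge> N" for n
  proof -
    have s: "\<sigma> n \<in> M" using \<sigma> by (auto simp: MCauchy_def)
    show ?thesis
      using LIMSEQ_le_const2[OF completion_dist_lim[OF completion_embed_in[OF s] cauchy_class_in[OF \<sigma>]
        const_in_completion_embed[OF s] self_in_cauchy_class[OF \<sigma>]], of "e/2"] N[OF that]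
      by (meson less_imp_le)
  qed
  then show "\<exists>no. \<forall>n\<ge>no. norm (completion_dist M d (completion_embed (\<sigma> n)) (cauchy_rel M d `` {\<sigma>}) - 0) < e"
    using \<open>e > 0\<close> by (intro exI[of _ N]) (fastforce)
qed

lemma completion_embed_dense:
  "Metric_space.mtopology (completion_space M d) (completion_dist M d) closure_of (completion_embed ` M)
     = completion_space M d"
proof -
  interpret C: Metric_space "completion_space M d" "completion_dist M d"
    by (rule Metric_space_completion)
  have "\<exists>y\<in>completion_embed ` M. y \<in> C.mball P r" if P: "P \<in> completion_space M d" and "r > 0" for P r
  proof -
    obtain \<sigma> where s: "\<sigma> \<in> P" using P completion_class_nonempty by blast
    have c: "MCauchy \<sigma>" using completion_class_MCauchy P s by blast
    have eq: "P = cauchy_rel M d `` {\<sigma>}" by (rule completion_class_eq[OF P s])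
    have "(\<lambda>n. completion_dist M d (completion_embed (\<sigma> n)) P) \<longlonglongrightarrow> 0"
      using completion_dist_embed_seq[OF c] eq by simp
    from LIMSEQ_D[OF this \<open>r > 0\<close>]
    obtain n where n: "completion_dist M d (completion_embed (\<sigma> n)) P < r"
      by auto
    have s_in: "\<sigma> n \<in> M" using c by (auto simp: MCauchy_def)
    have "completion_embed (\<sigma> n) \<in> C.mball P r"
      using n P completion_embed_in[OF s_in] C.commute[of P] by (simp add: C.in_mball)
    then show ?thesis using s_in by blast
  qed
  then show ?thesis
    unfolding C.metric_closure_of by blast
qed

lemma mcomplete_completion: "Metric_space.mcomplete (completion_space M d) (completion_dist M d)"
proof -
  interpret C: Metric_space "completion_space M d" "completion_dist M d"
    by (rule Metric_space_completion)
  let ?D = "completion_dist M d"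
  show ?thesis unfolding C.mcomplete_def
  proof (intro allI impI)
    fix F assume F: "C.MCauchy F"
    then have F_in: "F n \<in> completion_space M d" for n
      by (auto simp: C.MCauchy_def)
    have "\<exists>x\<in>M. ?D (completion_embed x) (F n) < 1 / real (Suc n)" for n
    proof -
      have "F n \<in> C.mtopology closure_of (completion_embed ` M)"
        using F_in completion_embed_dense by simp
      then obtain y where "y \<in> completion_embed ` M" "y \<in> C.mball (F n) (1 / real (Suc n))"
        unfolding C.metric_closure_of using zero_less_divide_1_iff of_nat_0_less_iff zero_less_Suc by blast
      then show ?thesis using C.commute[of "F n"] by (auto simp: C.in_mball)
    qed
    then obtain x where x: "\<And>n. x n \<in> M" "\<And>n. ?D (completion_embed (x n)) (F n) < 1 / real (Suc n)"
      by metis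
    let ?x = "\<lambda>n. completion_embed (x n)"
    have x_in: "?x n \<in> completion_space M d" for n using x completion_embed_in by blast
    have lim: "(\<lambda>n. ?D (?x n) (F n)) \<longlonglongrightarrow> 0"
    proof (rule Lim_null_comparison)
      show "\<forall>\<^sub>F n in sequentially. norm (?D (?x n) (F n)) \<le> 1 / real (Suc n)"
        using x(2) by (intro always_eventually) (auto intro: less_imp_le)
      show "(\<lambda>n. 1 / real (Suc n)) \<longlonglongrightarrow> 0"
        using LIMSEQ_inverse_real_of_nat by (simp add: field_simps)
    qed
    have "MCauchy x" unfolding MCauchy_def
    proof (intro conjI allI impI)
      show "range x \<subseteq> M" using x by blast
      fix e :: real assume "e > 0"
      then have e: "e/3 > 0" by simp
      obtain N1 where N1: "\<And>n n'. N1 \<le> n \<Longrightarrow> N1 \<le> n' \<Longrightarrow> ?D (F n) (F n') < e/3"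
        using F e unfolding C.MCauchy_def by meson
      obtain N2 where N2: "\<And>n. N2 \<le> n \<Longrightarrow> ?D (?x n) (F n) < e/3"
        using LIMSEQ_D[OF lim e] by auto
      have "d (x n) (x n') < e" if "max N1 N2 \<le> n" "max N1 N2 \<le> n'" for n n'
      proof -
        have "d (x n) (x n') = ?D (?x n) (?x n')" using x completion_dist_embed by simp
        also have "\<dots> \<le> ?D (?x n) (F n) + ?D (F n) (F n') + ?D (F n') (?x n')"
          using C.triangle[OF x_in[of n] F_in[of n] x_in[of n']] C.triangle[OF F_in[of n] F_in[of n'] x_in[of n']] by simp
        also have "\<dots> < e" using N1[of n n'] N2[of n] N2[of n'] that C.commute[of "F n'"] by simp
        finally show ?thesis .
      qed
      then show "\<exists>N. \<forall>n n'. N \<le> n \<longrightarrow> N \<le> n' \<longrightarrow> d (x n) (x n') < e" by blast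
    qed
    let ?L = "cauchy_rel M d `` {x}"
    have L_in: "?L \<in> completion_space M d" using \<open>MCauchy x\<close> cauchy_class_in by blast
    have "(\<lambda>n. ?D (F n) ?L) \<longlonglongrightarrow> 0"
    proof (rule Lim_null_comparison)
      have "norm (?D (F n) ?L) \<le> ?D (?x n) (F n) + ?D (?x n) ?L" for n
        using C.triangle[OF F_in[of n] x_in[of n] L_in] C.commute[of "F n" "?x n"] by simp
      then show "\<forall>\<^sub>F n in sequentially. norm (?D (F n) ?L) \<le> ?D (?x n) (F n) + ?D (?x n) ?L"
        by (rule always_eventually[OF allI])
      show "(\<lambda>n. ?D (?x n) (F n) + ?D (?x n) ?L) \<longlonglongrightarrow> 0"
        using tendsto_add[OF lim completion_dist_embed_seq[OF \<open>MCauchy x\<close>]] by simp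
    qed
    then have "limitin C.mtopology F ?L sequentially"
      using L_in F_in by (simp add: C.limitin_metric_dist_null)
    then show "\<exists>L. limitin C.mtopology F L sequentially" by blast
  qed
qed

end

section \<open>The Lipschitz multi-armed bandit problem\<close>

text \<open>An \<^emph>\<open>arm space\<close> equips \<open>X\<close> with a \<open>\<sigma>\<close>-algebra (carried by a measure \<open>M\<close> of which only
  \<^term>\<open>sets M\<close> matters) containing the Borel sets of the metric. Algorithms and reward
  distributions are required to be measurable with respect to it, so that the expectation in the
  regret exists. The Borel \<open>\<sigma>\<close>-algebra and the discrete one are the extreme cases; for the latter
  the measurability requirement on the reward distributions is void.\<close>

definition arm_space :: "'a set \<Rightarrow> ('a \<Rightarrow> 'a \<Rightarrow> real) \<Rightarrow> 'a measure \<Rightarrow> bool" where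
  "arm_space X D M \<longleftrightarrow> space M = X \<and> (\<forall>U. openin (Metric_space.mtopology X D) U \<longrightarrow> U \<in> sets M)"

definition lipschitz_mab_instance ::
  "'a set \<Rightarrow> ('a \<Rightarrow> 'a \<Rightarrow> real) \<Rightarrow> 'a measure \<Rightarrow> ('a \<Rightarrow> real) \<Rightarrow> ('a \<Rightarrow> real measure) \<Rightarrow> bool" where
  "lipschitz_mab_instance X D M \<mu> \<nu> \<longleftrightarrow>
     \<mu> \<in> X \<rightarrow> {0..1} \<and>
     (\<forall>x\<in>X. \<forall>y\<in>X. \<bar>\<mu> x - \<mu> y\<bar> \<le> D x y) \<and>
     \<nu> \<in> M \<rightarrow>\<^sub>M prob_algebra borel \<and>
     (\<forall>x\<in>X. emeasure (\<nu> x) {0..1} = 1 \<and> (\<integral>y. y \<partial>\<nu> x) = \<mu> x)"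

text \<open>A (randomized) algorithm maps the history of the rounds \<open>0, \<dots>, t - 1\<close>, a sequence of pairs
  (arm, reward), to the distribution of the arm picked in round \<open>t\<close>.\<close>

definition bandit_algorithm :: "'a measure \<Rightarrow> (nat \<Rightarrow> (nat \<Rightarrow> 'a \<times> real) \<Rightarrow> 'a measure) \<Rightarrow> bool" where
  "bandit_algorithm M A \<longleftrightarrow> (\<forall>t. A t \<in> PiM {0..<t} (\<lambda>_. M \<Otimes>\<^sub>M borel) \<rightarrow>\<^sub>M prob_algebra M)"

definition round_kernel ::
  "'a measure \<Rightarrow> (nat \<Rightarrow> (nat \<Rightarrow> 'a \<times> real) \<Rightarrow> 'a measure) \<Rightarrow> ('a \<Rightarrow> real measure) \<Rightarrow>
    nat \<Rightarrow> (nat \<Rightarrow> 'a \<times> real) \<Rightarrow> ('a \<times> real) measure" where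
  "round_kernel M A \<nu> t h = A t h \<bind> (\<lambda>x. distr (\<nu> x) (M \<Otimes>\<^sub>M borel) (\<lambda>y. (x, y)))"

text \<open>Law of the first \<open>t\<close> rounds: in the locale \<^locale>\<open>Ionescu_Tulcea\<close>, the constant \<open>C 0 t\<close> started in
  the empty history composes the first \<open>t\<close> kernels.\<close>

definition history_law ::
  "'a measure \<Rightarrow> (nat \<Rightarrow> (nat \<Rightarrow> 'a \<times> real) \<Rightarrow> 'a measure) \<Rightarrow> ('a \<Rightarrow> real measure) \<Rightarrow>
    nat \<Rightarrow> (nat \<Rightarrow> 'a \<times> real) measure" where
  "history_law M A \<nu> t =
     Ionescu_Tulcea.C (round_kernel M A \<nu>) (\<lambda>_. M \<Otimes>\<^sub>M borel) 0 t (\<lambda>_. undefined)"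

definition regret ::
  "'a measure \<Rightarrow> (nat \<Rightarrow> (nat \<Rightarrow> 'a \<times> real) \<Rightarrow> 'a measure) \<Rightarrow> ('a \<Rightarrow> real) \<Rightarrow> ('a \<Rightarrow> real measure) \<Rightarrow>
    nat \<Rightarrow> real" where
  "regret M A \<mu> \<nu> t =
     real t * (SUP x\<in>space M. \<mu> x) - (\<integral>h. (\<Sum>s<t. \<mu> (fst (h s))) \<partial>history_law M A \<nu> t)"

definition tractable ::
  "'a set \<Rightarrow> ('a \<Rightarrow> 'a \<Rightarrow> real) \<Rightarrow> 'a measure \<Rightarrow> (nat \<Rightarrow> real) \<Rightarrow> bool" where
  "tractable X D M f \<longleftrightarrow>
     (\<exists>A. bandit_algorithm M A \<and>
       (\<forall>\<mu> \<nu>. lipschitz_mab_instance X D M \<mu> \<nu> \<longrightarrow>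
         (\<exists>C. \<forall>t\<ge>1. regret M A \<mu> \<nu> t \<le> C * f t)))"

lemma Ionescu_Tulcea_round_kernel:
  assumes A: "bandit_algorithm M A" and \<nu>: "\<nu> \<in> M \<rightarrow>\<^sub>M prob_algebra borel"
  shows "Ionescu_Tulcea (round_kernel M A \<nu>) (\<lambda>_. M \<Otimes>\<^sub>M borel)"
proof -
  have "(\<lambda>x. distr (\<nu> x) (M \<Otimes>\<^sub>M borel) (\<lambda>y. (x, y))) \<in> M \<rightarrow>\<^sub>M prob_algebra (M \<Otimes>\<^sub>M borel)"
    using \<nu> by (intro measurable_distr_prob_space2[where M = borel]) auto
  then have *: "round_kernel M A \<nu> t \<in> PiM {0..<t} (\<lambda>_. M \<Otimes>\<^sub>M borel) \<rightarrow>\<^sub>M prob_algebra (M \<Otimes>\<^sub>M borel)" for t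
    unfolding round_kernel_def[abs_def] using A
    by (intro measurable_bind_prob_space[where N = M]) (auto simp: bandit_algorithm_def)
  show ?thesis
    by (rule Ionescu_Tulcea.intro, rule measurable_prob_algebraD[OF *])
       (drule measurable_space[OF *], simp add: space_prob_algebra)
qed

end

theory Submission
  imports Defs "HOL-Library.Discrete_Functions" "HOL-Real_Asymp.Real_Asymp"
begin

text \<open>The completion of \<open>X\<close> is compact iff \<open>X\<close> is totally bounded.

  If \<open>X\<close> is totally bounded, it has a sequence of arms whose initial segments are \<open>1/(k+1)\<close>-nets.
  Explore every arm of it infinitely often, but only in rounds that are perfect squares, and play an
  arm with the best empirical mean among a slowly growing initial segment in all others. The
  empirical mean of \<open>m\<close> explorations is within \<open>1/\<surd>m\<close> of the payoff in \<open>L\<^sup>1\<close>, so the expected gap in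
  the exploitation rounds tends to \<open>0\<close> at a rate independent of the instance, and the regret is
  sublinear by Cesaro averaging.

  Otherwise there are infinitely many disjoint balls of a fixed radius \<open>r\<close>. Hide in some of them
  needles of heights \<open>r (1 - 2^(-l-1))\<close>, with deterministic rewards. By a fixed time, a given algorithm
  is unlikely to have entered any ball of a late tail of the sequence. Hence the needles can be placed
  one after another such that the algorithm, run with only the first \<open>j\<close> needles present, has avoided
  the tail that receives the others with probability at least \<open>1/2\<close> up to time \<open>T\<^sub>j\<close>. As long as it
  avoids this tail it cannot tell the two payoffs apart, so its regret at \<open>T\<^sub>j\<close> is at least a constant
  times \<open>2^(-j) T\<^sub>j\<close>. As \<open>f\<close> is sublinear, the times \<open>T\<^sub>j\<close> can be fixed in advance such that this
  exceeds every multiple of \<open>f (T\<^sub>j)\<close>.\<close>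

section \<open>Total boundedness\<close>

lemma (in Metric_space12) mtotally_bounded_isometric_image:
  assumes S: "S \<subseteq> M1" and f: "f ` S \<subseteq> M2"
    and iso: "\<And>x y. x \<in> S \<Longrightarrow> y \<in> S \<Longrightarrow> d2 (f x) (f y) = d1 x y"
  shows "M2.mtotally_bounded (f ` S) \<longleftrightarrow> M1.mtotally_bounded S"
proof -
  have Cauchy: "M2.MCauchy (f \<circ> \<tau>) \<longleftrightarrow> M1.MCauchy \<tau>" if \<tau>: "range \<tau> \<subseteq> S" for \<tau> :: "nat \<Rightarrow> 'a"
  proof -
    have "range \<tau> \<subseteq> M1" "range (f \<circ> \<tau>) \<subseteq> M2"
      using \<tau> S f by auto
    moreover have "d2 ((f \<circ> \<tau>) m) ((f \<circ> \<tau>) n) = d1 (\<tau> m) (\<tau> n)" for m n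
      using \<tau> by (auto intro!: iso)
    ultimately show ?thesis
      by (simp only: M1.MCauchy_def M2.MCauchy_def)
  qed
  have lift: "range \<sigma> \<subseteq> f ` S \<longleftrightarrow> (\<exists>\<tau>. range \<tau> \<subseteq> S \<and> \<sigma> = f \<circ> \<tau>)" for \<sigma> :: "nat \<Rightarrow> 'b"
    by (simp add: image_subset_iff image_iff Bex_def fun_eq_iff choice_iff all_conj_distrib)
  have "M2.mtotally_bounded (f ` S) \<longleftrightarrow>
      (\<forall>\<tau>::nat \<Rightarrow> 'a. range \<tau> \<subseteq> S \<longrightarrow> (\<exists>r. strict_mono r \<and> M2.MCauchy (f \<circ> (\<tau> \<circ> r))))"
    unfolding M2.mtotally_bounded_sequentially lift comp_assoc[symmetric] using f by blast
  also have "\<dots> \<longleftrightarrow> (\<forall>\<tau>::nat \<Rightarrow> 'a. range \<tau> \<subseteq> S \<longrightarrow> (\<exists>r. strict_mono r \<and> M1.MCauchy (\<tau> \<circ> r)))"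
  proof -
    have "M2.MCauchy (f \<circ> (\<tau> \<circ> r)) \<longleftrightarrow> M1.MCauchy (\<tau> \<circ> r)"
      if "range \<tau> \<subseteq> S" for \<tau> and r :: "nat \<Rightarrow> nat"
      using that by (intro Cauchy) auto
    then show ?thesis by metis
  qed
  also have "\<dots> \<longleftrightarrow> M1.mtotally_bounded S"
    using S by (simp add: M1.mtotally_bounded_sequentially)
  finally show ?thesis .
qed

context Metric_space
begin

lemma compact_completion_iff_mtotally_bounded:
  "compact_space (Metric_space.mtopology (completion_space M d) (completion_dist M d)) \<longleftrightarrow>
     mtotally_bounded M"
proof -
  interpret Metric_space12 M d "completion_space M d" "completion_dist M d"
    by (intro Metric_space12.intro Metric_space_axioms Metric_space_completion)
  have embed: "completion_embed ` M \<subseteq> completion_space M d"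
    using completion_embed_in by blast
  have "compact_space M2.mtopology \<longleftrightarrow>
      M2.mtotally_bounded (M2.mtopology closure_of (completion_embed ` M))"
    by (simp add: M2.compact_space_eq_mcomplete_mtotally_bounded mcomplete_completion
        completion_embed_dense)
  also have "\<dots> \<longleftrightarrow> M2.mtotally_bounded (completion_embed ` M)"
    by (rule M2.mtotally_bounded_closure_of_eq[OF embed])
  also have "\<dots> \<longleftrightarrow> mtotally_bounded M"
    using embed completion_dist_embed by (intro mtotally_bounded_isometric_image) auto
  finally show ?thesis .
qed

lemma net_sequence_if_mtotally_bounded:
  assumes bounded: "mtotally_bounded M" and nonempty: "M \<noteq> {}"
  obtains a :: "nat \<Rightarrow> 'a" and N :: "nat \<Rightarrow> nat" where "range a \<subseteq> M"
    "\<And>k y. y \<in> M \<Longrightarrow> \<exists>i<N k. d y (a i) < 1 / real (Suc k)"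
proof -
  have "\<forall>k. \<exists>K. finite K \<and> K \<subseteq> M \<and> M \<subseteq> (\<Union>x\<in>K. mball x (1 / real (Suc k)))"
    using bounded unfolding mtotally_bounded_def by simp
  then obtain K where nets: "\<And>k. finite (K k)" "\<And>k. K k \<subseteq> M"
    "\<And>k. M \<subseteq> (\<Union>x\<in>K k. mball x (1 / real (Suc k)))"
    by metis
  define a where "a = from_nat_into (\<Union>k. K k)"
  have "countable (\<Union>k. K k)" using nets(1) by (auto intro: countable_finite)
  moreover have "(\<Union>k. K k) \<noteq> {}" using nets(3)[of 0] nonempty by auto
  ultimately have range_a: "range a = (\<Union>k. K k)"
    unfolding a_def by (intro range_from_nat_into)
  have "\<exists>n. K k \<subseteq> a ` {..<n}" for k
  proof -
    obtain I where index: "finite I" "K k = a ` I"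
      using finite_subset_image[OF nets(1), of k a UNIV] range_a by blast
    then obtain n where "I \<subseteq> {..<n}" using finite_nat_bounded by blast
    with index show ?thesis by blast
  qed
  then obtain N where covered: "\<And>k. K k \<subseteq> a ` {..<N k}" by metis
  show thesis
  proof
    show "range a \<subseteq> M" using range_a nets(2) by blast
    fix k y assume "y \<in> M"
    then obtain x where "x \<in> K k" "y \<in> mball x (1 / real (Suc k))" using nets(3) by blast
    with covered show "\<exists>i<N k. d y (a i) < 1 / real (Suc k)" by (force simp: commute)
  qed
qed

lemma separated_sequence_if_not_mtotally_bounded:
  assumes "\<not> mtotally_bounded M"
  obtains e :: real and a :: "nat \<Rightarrow> 'a"
  where "e > 0" "range a \<subseteq> M" "\<And>i j. i \<noteq> j \<Longrightarrow> e \<le> d (a i) (a j)"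
proof -
  obtain e where "e > 0" and no_net: "\<And>K. finite K \<Longrightarrow> K \<subseteq> M \<Longrightarrow> \<not> M \<subseteq> (\<Union>x\<in>K. mball x e)"
    using assms unfolding mtotally_bounded_def by meson
  have "\<exists>a. \<forall>n::nat. a n \<in> M \<and> (\<forall>i<n. e \<le> d (a i) (a n))"
  proof (rule dependent_wf_choice[OF wf_less_than,
        where P = "\<lambda>a n x. x \<in> M \<and> (\<forall>i<n. e \<le> d (a i) x)"])
    fix n :: nat and a :: "nat \<Rightarrow> 'a"
    assume "\<And>i. (i, n) \<in> less_than \<Longrightarrow> a i \<in> M \<and> (\<forall>j<i. e \<le> d (a j) (a i))"
    then have centers: "a ` {..<n} \<subseteq> M" by auto
    then obtain x where "x \<in> M" "\<And>i. i < n \<Longrightarrow> x \<notin> mball (a i) e"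
      using no_net[of "a ` {..<n}"] by blast
    with centers show "\<exists>x. x \<in> M \<and> (\<forall>i<n. e \<le> d (a i) x)"
      by (auto simp: image_subset_iff not_less intro!: exI[of _ x])
  qed auto
  then obtain a :: "nat \<Rightarrow> 'a"
    where sequence: "\<And>n. a n \<in> M" "\<And>i n. i < n \<Longrightarrow> e \<le> d (a i) (a n)" by metis
  show thesis
  proof
    show "e \<le> d (a i) (a j)" if "i \<noteq> j" for i j
      using sequence(2) commute that by (metis linorder_neqE_nat)
  qed (use sequence \<open>e > 0\<close> in auto)
qed

end

lemma measurable_if_Lipschitz:
  fixes \<phi> :: "'a \<Rightarrow> real"
  assumes "Metric_space X D" and arms: "arm_space X D M"
    and Lipschitz: "\<And>x y. x \<in> X \<Longrightarrow> y \<in> X \<Longrightarrow> \<bar>\<phi> x - \<phi> y\<bar> \<le> D x y"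
  shows "\<phi> \<in> borel_measurable M"
proof (rule borel_measurableI)
  interpret Metric_space X D by fact
  have "continuous_map mtopology (Metric_space.mtopology UNIV dist) \<phi>"
    unfolding metric_continuous_map[OF Met_TC.Metric_space_axioms] dist_real_def
    using Lipschitz by (meson le_less_trans subset_UNIV)
  then have continuous: "continuous_map mtopology euclideanreal \<phi>" by simp
  fix S :: "real set" assume "open S"
  with continuous have "openin mtopology {x \<in> X. \<phi> x \<in> S}"
    using openin_continuous_map_preimage[of mtopology euclideanreal \<phi> S] by simp
  moreover have "\<phi> -` S \<inter> space M = {x \<in> X. \<phi> x \<in> S}"
    using arms by (auto simp: arm_space_def)
  ultimately show "\<phi> -` S \<inter> space M \<in> sets M"
    using arms by (simp add: arm_space_def)
qed

section \<open>Laws of histories\<close>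

lemma measurable_round_arm [measurable (raw)]:
  "(s::nat) < t \<Longrightarrow> (\<lambda>h. fst (h s)) \<in> PiM {0..<t} (\<lambda>_. M \<Otimes>\<^sub>M N) \<rightarrow>\<^sub>M M"
  by (rule measurable_compose[OF measurable_component_singleton[where M = "\<lambda>_. M \<Otimes>\<^sub>M N"]
        measurable_fst]) simp

lemma measurable_round_reward [measurable (raw)]:
  "(s::nat) < t \<Longrightarrow> (\<lambda>h. snd (h s)) \<in> PiM {0..<t} (\<lambda>_. M \<Otimes>\<^sub>M N) \<rightarrow>\<^sub>M N"
  by (rule measurable_compose[OF measurable_component_singleton[where M = "\<lambda>_. M \<Otimes>\<^sub>M N"]
        measurable_snd]) simp

locale bandit_run =
  fixes M :: "'a measure" and A :: "nat \<Rightarrow> (nat \<Rightarrow> 'a \<times> real) \<Rightarrow> 'a measure"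
    and \<nu> :: "'a \<Rightarrow> real measure"
  assumes algorithm: "bandit_algorithm M A"
    and reward_kernel [measurable]: "\<nu> \<in> M \<rightarrow>\<^sub>M prob_algebra borel"
begin

abbreviation histories :: "nat \<Rightarrow> (nat \<Rightarrow> 'a \<times> real) measure" where
  "histories t \<equiv> PiM {0..<t} (\<lambda>_. M \<Otimes>\<^sub>M borel)"

abbreviation law :: "nat \<Rightarrow> (nat \<Rightarrow> 'a \<times> real) measure" where
  "law \<equiv> history_law M A \<nu>"

sublocale IT: Ionescu_Tulcea "round_kernel M A \<nu>" "\<lambda>_. M \<Otimes>\<^sub>M borel"
  by (rule Ionescu_Tulcea_round_kernel[OF algorithm reward_kernel])

lemma algorithm_measurable [measurable]: "A t \<in> histories t \<rightarrow>\<^sub>M prob_algebra M"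
  using algorithm by (simp add: bandit_algorithm_def)

lemma sets_algorithm: "h \<in> space (histories t) \<Longrightarrow> sets (A t h) = sets M"
  and space_algorithm: "h \<in> space (histories t) \<Longrightarrow> space (A t h) = space M"
  and prob_space_algorithm: "h \<in> space (histories t) \<Longrightarrow> prob_space (A t h)"
  using measurable_space[OF algorithm_measurable]
  by (auto simp: space_prob_algebra dest: sets_eq_imp_space_eq)

lemma sets_reward: "x \<in> space M \<Longrightarrow> sets (\<nu> x) = sets borel"
  and prob_space_reward: "x \<in> space M \<Longrightarrow> prob_space (\<nu> x)"
  using measurable_space[OF reward_kernel] by (auto simp: space_prob_algebra)

lemma start_in: "(\<lambda>_. undefined) \<in> space (histories 0)"
  by (simp add: space_PiM)

lemma sets_law [measurable_cong, simp]: "sets (law t) = sets (histories t)"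
  using IT.sets_C[OF start_in, of t] by (simp add: history_law_def)

lemma space_law: "space (law t) = space (histories t)"
  by (rule sets_eq_imp_space_eq) simp

lemma prob_space_law: "prob_space (law t)"
  using IT.prob_space_C[OF start_in, of t] by (simp add: history_law_def)

lemma law_0: "law 0 = return (histories 0) (\<lambda>_. undefined)"
  by (simp add: history_law_def)

lemma law_eq_distr_law: "s \<le> t \<Longrightarrow> law s = distr (law t) (histories s) (\<lambda>h. restrict h {0..<s})"
  using IT.distr_C[OF _ start_in, of s t] by (simp add: history_law_def)

lemma nn_integral_law_restrict:
  assumes "s \<le> t" and F: "F \<in> borel_measurable (histories s)"
  shows "(\<integral>\<^sup>+h. F (restrict h {0..<s}) \<partial>law t) = (\<integral>\<^sup>+h. F h \<partial>law s)"
  using IT.nn_integral_C[OF assms(1) _ _ start_in, of F] F by (simp add: history_law_def)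

lemma arms_nonempty: "space M \<noteq> {}"
  using prob_space.not_empty[OF prob_space_algorithm[OF start_in]] space_algorithm[OF start_in] by simp

lemma round_arm_in: "h \<in> space (law t) \<Longrightarrow> s < t \<Longrightarrow> fst (h s) \<in> space M"
  using measurable_space[OF measurable_round_arm] by (simp add: space_law)

lemma measurable_extend_history [measurable (raw)]:
  assumes "f \<in> N \<rightarrow>\<^sub>M histories t" "g \<in> N \<rightarrow>\<^sub>M M \<Otimes>\<^sub>M borel"
  shows "(\<lambda>z. (f z)(t := g z)) \<in> N \<rightarrow>\<^sub>M histories (Suc t)"
  using assms by (intro measurable_fun_upd[where J = "{0..<t}"]) auto

lemma extend_history_in:
  "h \<in> space (histories t) \<Longrightarrow> x \<in> space M \<Longrightarrow> h(t := (x, y)) \<in> space (histories (Suc t))"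
  using measurable_space[OF measurable_extend_history[OF measurable_const measurable_ident],
      of h t "(x, y)"]
  by (simp add: space_pair_measure)

lemma measurable_reward_integral:
  assumes F [measurable]: "F \<in> borel_measurable (histories (Suc t))"
  shows "(\<lambda>(h, x). \<integral>\<^sup>+y. F (h(t := (x, y))) \<partial>\<nu> x) \<in> borel_measurable (histories t \<Otimes>\<^sub>M M)"
  unfolding case_prod_unfold
proof (rule nn_integral_measurable_subprob_algebra2)
  show "(\<lambda>(p, y). F ((fst p)(t := (snd p, y)))) \<in> borel_measurable ((histories t \<Otimes>\<^sub>M M) \<Otimes>\<^sub>M borel)"
    unfolding case_prod_unfold by (rule measurable_compose[OF measurable_extend_history F]) measurable
  show "(\<lambda>p. \<nu> (snd p)) \<in> histories t \<Otimes>\<^sub>M M \<rightarrow>\<^sub>M subprob_algebra borel"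
    by (rule measurable_compose[OF measurable_snd measurable_prob_algebraD[OF reward_kernel]])
qed

lemma measurable_round_integral:
  assumes F: "F \<in> borel_measurable (histories (Suc t))"
  shows "(\<lambda>h. \<integral>\<^sup>+x. \<integral>\<^sup>+y. F (h(t := (x, y))) \<partial>\<nu> x \<partial>A t h) \<in> borel_measurable (histories t)"
  by (rule nn_integral_measurable_subprob_algebra2[OF measurable_reward_integral[OF F]
        measurable_prob_algebraD[OF algorithm_measurable]])

lemma nn_integral_round_kernel:
  assumes h: "h \<in> space (histories t)" and G [measurable]: "G \<in> borel_measurable (M \<Otimes>\<^sub>M borel)"
  shows "(\<integral>\<^sup>+z. G z \<partial>round_kernel M A \<nu> t h) = (\<integral>\<^sup>+x. \<integral>\<^sup>+y. G (x, y) \<partial>\<nu> x \<partial>A t h)"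
proof -
  have kernel: "(\<lambda>x. distr (\<nu> x) (M \<Otimes>\<^sub>M borel) (\<lambda>y. (x, y))) \<in> A t h \<rightarrow>\<^sub>M subprob_algebra (M \<Otimes>\<^sub>M borel)"
    unfolding measurable_cong_sets[OF sets_algorithm[OF h] refl]
    by (intro measurable_prob_algebraD measurable_distr_prob_space2[where M = borel]) auto
  have "(\<integral>\<^sup>+z. G z \<partial>round_kernel M A \<nu> t h) =
      (\<integral>\<^sup>+x. \<integral>\<^sup>+z. G z \<partial>distr (\<nu> x) (M \<Otimes>\<^sub>M borel) (\<lambda>y. (x, y)) \<partial>A t h)"
    unfolding round_kernel_def by (rule nn_integral_bind[OF G kernel])
  also have "\<dots> = (\<integral>\<^sup>+x. \<integral>\<^sup>+y. G (x, y) \<partial>\<nu> x \<partial>A t h)"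
  proof (rule nn_integral_cong)
    fix x assume "x \<in> space (A t h)"
    then have x: "x \<in> space M" by (simp add: space_algorithm[OF h])
    note [measurable_cong] = sets_reward[OF x]
    show "(\<integral>\<^sup>+z. G z \<partial>distr (\<nu> x) (M \<Otimes>\<^sub>M borel) (\<lambda>y. (x, y))) = (\<integral>\<^sup>+y. G (x, y) \<partial>\<nu> x)"
      using x by (subst nn_integral_distr) auto
  qed
  finally show ?thesis .
qed

lemma nn_integral_law_Suc:
  assumes F [measurable]: "F \<in> borel_measurable (histories (Suc t))"
  shows "(\<integral>\<^sup>+h. F h \<partial>law (Suc t)) = (\<integral>\<^sup>+h. \<integral>\<^sup>+x. \<integral>\<^sup>+y. F (h(t := (x, y))) \<partial>\<nu> x \<partial>A t h \<partial>law t)"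
proof -
  have "(\<integral>\<^sup>+h. F h \<partial>law (Suc t)) = (\<integral>\<^sup>+h. \<integral>\<^sup>+h'. F h' \<partial>IT.eP t h \<partial>law t)"
    unfolding history_law_def IT.C.simps add_0
    by (rule nn_integral_bind[OF F])
      (use IT.measurable_eP[of t] sets_law[of t] in
        \<open>simp add: history_law_def cong: measurable_cong_sets\<close>)
  also have "\<dots> = (\<integral>\<^sup>+h. \<integral>\<^sup>+z. F (h(t := z)) \<partial>round_kernel M A \<nu> t h \<partial>law t)"
    by (intro nn_integral_cong IT.nn_integral_eP F) (simp add: space_law)
  also have "\<dots> = (\<integral>\<^sup>+h. \<integral>\<^sup>+x. \<integral>\<^sup>+y. F (h(t := (x, y))) \<partial>\<nu> x \<partial>A t h \<partial>law t)"
    by (intro nn_integral_cong nn_integral_round_kernel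
        measurable_compose[OF measurable_extend_history F])
       (auto simp: space_law)
  finally show ?thesis .
qed

lemma nn_integral_law_Suc_return:
  assumes arm: "\<And>h. h \<in> space (histories t) \<Longrightarrow> A t h = return M (g h)"
    and g: "\<And>h. h \<in> space (histories t) \<Longrightarrow> g h \<in> space M"
    and F: "F \<in> borel_measurable (histories (Suc t))"
  shows "(\<integral>\<^sup>+h. F h \<partial>law (Suc t)) = (\<integral>\<^sup>+h. \<integral>\<^sup>+y. F (h(t := (g h, y))) \<partial>\<nu> (g h) \<partial>law t)"
  unfolding nn_integral_law_Suc[OF F]
proof (rule nn_integral_cong)
  fix h assume "h \<in> space (law t)"
  then have h: "h \<in> space (histories t)" by (simp add: space_law)
  have "(\<lambda>x. \<integral>\<^sup>+y. F (h(t := (x, y))) \<partial>\<nu> x) \<in> borel_measurable M"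
    using measurable_compose[OF measurable_Pair1'[OF h] measurable_reward_integral[OF F]] by simp
  then show "(\<integral>\<^sup>+x. \<integral>\<^sup>+y. F (h(t := (x, y))) \<partial>\<nu> x \<partial>A t h) = (\<integral>\<^sup>+y. F (h(t := (g h, y))) \<partial>\<nu> (g h))"
    using g[OF h] by (simp add: arm[OF h] nn_integral_return)
qed

lemma distr_law_Suc_arm: "distr (law (Suc t)) M (\<lambda>h. fst (h t)) = law t \<bind> A t"
proof (rule measure_eqI)
  have kernel: "A t \<in> law t \<rightarrow>\<^sub>M subprob_algebra M"
    by (intro measurable_prob_algebraD) simp
  have nonempty: "space (law t) \<noteq> {}"
    by (rule prob_space.not_empty[OF prob_space_law])
  show "sets (distr (law (Suc t)) M (\<lambda>h. fst (h t))) = sets (law t \<bind> A t)"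
    using sets_bind[of "law t" "A t" M, OF sets_kernel[OF kernel] nonempty] by simp
  fix E assume "E \<in> sets (distr (law (Suc t)) M (\<lambda>h. fst (h t)))"
  then have E [measurable]: "E \<in> sets M" by simp
  have "emeasure (distr (law (Suc t)) M (\<lambda>h. fst (h t))) E =
      (\<integral>\<^sup>+x. indicator E x \<partial>distr (law (Suc t)) M (\<lambda>h. fst (h t)))"
    by simp
  also have "\<dots> = (\<integral>\<^sup>+h. indicator E (fst (h t)) \<partial>law (Suc t))"
    by (rule nn_integral_distr) simp_all
  also have "\<dots> = (\<integral>\<^sup>+h. \<integral>\<^sup>+x. \<integral>\<^sup>+y. indicator E x \<partial>\<nu> x \<partial>A t h \<partial>law t)"
    by (subst nn_integral_law_Suc) simp_all
  also have "\<dots> = (\<integral>\<^sup>+h. emeasure (A t h) E \<partial>law t)"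
  proof (rule nn_integral_cong)
    fix h assume "h \<in> space (law t)"
    then have h: "h \<in> space (histories t)" by (simp add: space_law)
    have "(\<integral>\<^sup>+x. \<integral>\<^sup>+y. indicator E x \<partial>\<nu> x \<partial>A t h) = (\<integral>\<^sup>+x. indicator E x \<partial>A t h)"
      using prob_space.emeasure_space_1[OF prob_space_reward]
      by (intro nn_integral_cong) (simp add: space_algorithm[OF h])
    then show "(\<integral>\<^sup>+x. \<integral>\<^sup>+y. indicator E x \<partial>\<nu> x \<partial>A t h) = emeasure (A t h) E"
      by (simp add: sets_algorithm[OF h])
  qed
  also have "\<dots> = emeasure (law t \<bind> A t) E"
    by (rule emeasure_bind[symmetric, OF nonempty kernel E])
  finally show "emeasure (distr (law (Suc t)) M (\<lambda>h. fst (h t))) E = emeasure (law t \<bind> A t) E" .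
qed

lemma distr_law_round_arm:
  assumes "s < t"
  shows "distr (law t) M (\<lambda>h. fst (h s)) = law s \<bind> A s"
proof -
  have "distr (law t) M (\<lambda>h. fst (h s)) =
      distr (law t) M ((\<lambda>h. fst (h s)) \<circ> (\<lambda>h. restrict h {0..<Suc s}))"
    by (simp add: comp_def)
  also have "\<dots> = distr (law (Suc s)) M (\<lambda>h. fst (h s))"
    unfolding law_eq_distr_law[OF Suc_leI[OF assms]] using assms
    by (intro distr_distr[symmetric]) (auto intro!: measurable_restrict_subset)
  finally show ?thesis by (simp only: distr_law_Suc_arm)
qed

end

section \<open>Regret\<close>

locale bandit_instance = bandit_run M A \<nu> for M :: "'a measure" and A \<nu> +
  fixes \<mu> :: "'a \<Rightarrow> real"
  assumes payoff_measurable [measurable]: "\<mu> \<in> borel_measurable M"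
    and reward_range: "x \<in> space M \<Longrightarrow> emeasure (\<nu> x) {0..1} = 1"
    and reward_mean: "x \<in> space M \<Longrightarrow> (\<integral>y. y \<partial>\<nu> x) = \<mu> x"
    and payoff_range: "x \<in> space M \<Longrightarrow> \<mu> x \<in> {0..1}"

lemma bandit_instance_if_Lipschitz:
  assumes "Metric_space X D" "arm_space X D M" "bandit_algorithm M A" "lipschitz_mab_instance X D M \<mu> \<nu>"
  shows "bandit_instance M A \<nu> \<mu>"
proof
  have "space M = X" using assms(2) by (simp add: arm_space_def)
  then show "\<mu> x \<in> {0..1}" "emeasure (\<nu> x) {0..1} = 1" "(\<integral>y. y \<partial>\<nu> x) = \<mu> x" if "x \<in> space M" for x
    using that assms(4) by (auto simp: lipschitz_mab_instance_def Pi_iff)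
  show "\<mu> \<in> borel_measurable M"
    using assms by (intro measurable_if_Lipschitz) (auto simp: lipschitz_mab_instance_def)
qed (use assms in \<open>auto simp: lipschitz_mab_instance_def\<close>)

context bandit_instance
begin

definition gap :: "'a \<Rightarrow> real" where
  "gap x = (SUP x\<in>space M. \<mu> x) - \<mu> x"

lemma gap_measurable [measurable]: "gap \<in> borel_measurable M"
  unfolding gap_def[abs_def] by simp

lemma bdd_above_payoff: "bdd_above (\<mu> ` space M)"
  using payoff_range by (intro bdd_aboveI2[of _ _ 1]) auto

lemma gap_nonneg: "x \<in> space M \<Longrightarrow> 0 \<le> gap x"
  using cSUP_upper[OF _ bdd_above_payoff] by (simp add: gap_def)

lemma gap_le_1:
  assumes "x \<in> space M"
  shows "gap x \<le> 1"
proof -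
  have "(SUP x\<in>space M. \<mu> x) \<le> 1"
    using arms_nonempty payoff_range by (intro cSUP_least) auto
  then show ?thesis using payoff_range[OF assms] by (simp add: gap_def)
qed

lemma integrable_gap: "prob_space N \<Longrightarrow> g \<in> N \<rightarrow>\<^sub>M M \<Longrightarrow> integrable N (\<lambda>z. gap (g z))"
  using gap_nonneg gap_le_1 measurable_space[of g N M]
  by (intro finite_measure.integrable_const_bound[OF prob_space.finite_measure, of N _ 1]) auto

lemma expected_gap_le_1:
  assumes "prob_space N" and g [measurable]: "g \<in> N \<rightarrow>\<^sub>M M"
  shows "(\<integral>z. gap (g z) \<partial>N) \<le> 1"
proof -
  interpret prob_space N by fact
  show ?thesis
    using integral_mono[OF integrable_gap[OF assms] integrable_const[of 1]] gap_le_1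
      measurable_space[OF g] by (simp add: prob_space)
qed

lemma regret_eq_expected_gaps: "regret M A \<mu> \<nu> t = (\<integral>h. (\<Sum>s<t. gap (fst (h s))) \<partial>law t)"
proof -
  interpret prob_space "law t" by (rule prob_space_law)
  have "integrable (law t) (\<lambda>h. \<mu> (fst (h s)))" if "s < t" for s
    using payoff_range round_arm_in[OF _ that] that by (intro integrable_const_bound[of _ 1]) auto
  then have integrable: "integrable (law t) (\<lambda>h. \<Sum>s<t. \<mu> (fst (h s)))"
    by (intro Bochner_Integration.integrable_sum) simp
  have "(\<integral>h. (\<Sum>s<t. gap (fst (h s))) \<partial>law t) =
      (\<integral>h. real t * (SUP x\<in>space M. \<mu> x) - (\<Sum>s<t. \<mu> (fst (h s))) \<partial>law t)"
    by (simp add: gap_def sum_subtractf)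
  also have "\<dots> = real t * (SUP x\<in>space M. \<mu> x) - (\<integral>h. (\<Sum>s<t. \<mu> (fst (h s))) \<partial>law t)"
    using integrable by (simp add: prob_space)
  finally show ?thesis by (simp add: regret_def)
qed

lemma regret_eq_sum: "regret M A \<mu> \<nu> t = (\<Sum>s<t. \<integral>x. gap x \<partial>(law s \<bind> A s))"
proof -
  have "regret M A \<mu> \<nu> t = (\<Sum>s<t. \<integral>h. gap (fst (h s)) \<partial>law t)"
    unfolding regret_eq_expected_gaps
    by (intro Bochner_Integration.integral_sum integrable_gap prob_space_law) simp
  also have "\<dots> = (\<Sum>s<t. \<integral>x. gap x \<partial>(law s \<bind> A s))"
    by (simp add: distr_law_round_arm[symmetric] integral_distr)
  finally show ?thesis .
qed

end

section \<open>Empirical means\<close>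

lemma (in prob_space) expectation_abs_le_sqrt_second_moment:
  fixes Y :: "'a \<Rightarrow> real"
  assumes Y: "Y \<in> borel_measurable M" "integrable M (\<lambda>\<omega>. (Y \<omega>)\<^sup>2)"
  shows "expectation (\<lambda>\<omega>. \<bar>Y \<omega>\<bar>) \<le> sqrt (expectation (\<lambda>\<omega>. (Y \<omega>)\<^sup>2))"
proof -
  have "integrable M (\<lambda>\<omega>. \<bar>Y \<omega>\<bar>)"
    using square_integrable_imp_integrable[OF Y] by simp
  then show ?thesis
    using variance_positive[of "\<lambda>\<omega>. \<bar>Y \<omega>\<bar>"] Y(2) by (intro real_le_rsqrt) (simp add: variance_eq)
qed

lemma (in prob_space) nn_integral_shifted_square:
  fixes Y :: "'a \<Rightarrow> real"
  assumes Y: "integrable M Y" "integrable M (\<lambda>\<omega>. (Y \<omega>)\<^sup>2)"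
  shows "(\<integral>\<^sup>+\<omega>. ennreal ((z + (Y \<omega> - expectation Y))\<^sup>2) \<partial>M) = ennreal (z\<^sup>2 + variance Y)"
proof -
  have square: "(z + (Y \<omega> - m))\<^sup>2 = z\<^sup>2 + m\<^sup>2 - 2 * z * m + 2 * (z - m) * Y \<omega> + (Y \<omega>)\<^sup>2" for \<omega> m
    by (simp add: power2_eq_square algebra_simps)
  have "integrable M (\<lambda>\<omega>. (z + (Y \<omega> - expectation Y))\<^sup>2)"
    unfolding square using Y by (intro Bochner_Integration.integrable_add) auto
  moreover have "expectation (\<lambda>\<omega>. (z + (Y \<omega> - expectation Y))\<^sup>2) = z\<^sup>2 + variance Y"
    unfolding square variance_eq[OF Y] using Y by (simp add: prob_space power2_eq_square algebra_simps)
  ultimately show ?thesis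
    by (simp add: nn_integral_eq_integral)
qed

lemma (in prob_space) moments_if_in_unit_interval:
  fixes Y :: "'a \<Rightarrow> real"
  assumes Y [measurable]: "Y \<in> borel_measurable M" and range: "AE \<omega> in M. Y \<omega> \<in> {0..1}"
  shows "integrable M Y" "integrable M (\<lambda>\<omega>. (Y \<omega>)\<^sup>2)" "variance Y \<le> 1"
proof -
  show Y_int: "integrable M Y"
    by (rule integrable_const_bound[of _ 1]) (use range in auto)
  have square: "AE \<omega> in M. (Y \<omega>)\<^sup>2 \<le> 1"
    using range by eventually_elim (simp add: power_le_one)
  show Y2_int: "integrable M (\<lambda>\<omega>. (Y \<omega>)\<^sup>2)"
    by (rule integrable_const_bound[of _ 1]) (use square in auto)
  have "variance Y \<le> expectation (\<lambda>\<omega>. (Y \<omega>)\<^sup>2)"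
    using variance_eq[OF Y_int Y2_int] by simp
  also have "\<dots> \<le> 1"
    using integral_mono_AE[OF Y2_int integrable_const[of 1] square] by (simp add: prob_space)
  finally show "variance Y \<le> 1" .
qed

definition empirical_mean :: "nat set \<Rightarrow> (nat \<Rightarrow> 'a \<times> real) \<Rightarrow> real" where
  "empirical_mean S h = (\<Sum>s\<in>S. snd (h s)) / real (card S)"

lemma measurable_empirical_mean:
  "S \<subseteq> {..<t} \<Longrightarrow> empirical_mean S \<in> borel_measurable (PiM {0..<t} (\<lambda>_. M \<Otimes>\<^sub>M borel))"
  unfolding empirical_mean_def[abs_def]
  by (intro borel_measurable_divide borel_measurable_sum measurable_round_reward) auto

context bandit_instance
begin

lemma nn_integral_shifted_reward_square_le:
  assumes x: "x \<in> space M"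
  shows "(\<integral>\<^sup>+y. ennreal ((z + (y - \<mu> x))\<^sup>2) \<partial>\<nu> x) \<le> ennreal (z\<^sup>2 + 1)"
proof -
  interpret prob_space "\<nu> x" by (rule prob_space_reward[OF x])
  have "AE y in \<nu> x. y \<in> {0..1}"
    using reward_range[OF x] by (intro AE_prob_1) (simp add: measure_def)
  then have "integrable (\<nu> x) (\<lambda>y. y)" "integrable (\<nu> x) (\<lambda>y. y\<^sup>2)" "variance (\<lambda>y. y) \<le> 1"
    by (intro moments_if_in_unit_interval; simp add: sets_reward[OF x] cong: measurable_cong_sets)+
  then show ?thesis
    using nn_integral_shifted_square[of "\<lambda>y. y" z] by (simp add: reward_mean[OF x] ennreal_leI)
qed

lemma second_moment_Suc_le:
  assumes arm: "\<And>h. h \<in> space (histories t) \<Longrightarrow> A t h = return M a" and a: "a \<in> space M"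
    and Z [measurable]: "Z \<in> borel_measurable (histories t)"
  shows "(\<integral>\<^sup>+h. ennreal ((Z (restrict h {0..<t}) + (snd (h t) - \<mu> a))\<^sup>2) \<partial>law (Suc t)) \<le>
    (\<integral>\<^sup>+h. ennreal ((Z h)\<^sup>2) \<partial>law t) + 1"
proof -
  interpret prob_space "law t" by (rule prob_space_law)
  have [measurable]: "(\<lambda>h. restrict h {0..<t}) \<in> histories (Suc t) \<rightarrow>\<^sub>M histories t"
    by (rule measurable_restrict_subset) auto
  have "(\<integral>\<^sup>+h. ennreal ((Z (restrict h {0..<t}) + (snd (h t) - \<mu> a))\<^sup>2) \<partial>law (Suc t)) =
      (\<integral>\<^sup>+h. \<integral>\<^sup>+y. ennreal ((Z (restrict (h(t := (a, y))) {0..<t}) + (y - \<mu> a))\<^sup>2) \<partial>\<nu> a \<partial>law t)"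
    by (subst nn_integral_law_Suc_return[OF arm]) (use a in simp_all)
  also have "\<dots> = (\<integral>\<^sup>+h. \<integral>\<^sup>+y. ennreal ((Z h + (y - \<mu> a))\<^sup>2) \<partial>\<nu> a \<partial>law t)"
    by (rule nn_integral_cong) (simp add: space_law restrict_PiE_iff space_PiM)
  also have "\<dots> \<le> (\<integral>\<^sup>+h. ennreal ((Z h)\<^sup>2 + 1) \<partial>law t)"
    by (intro nn_integral_mono nn_integral_shifted_reward_square_le a)
  also have "\<dots> = (\<integral>\<^sup>+h. ennreal ((Z h)\<^sup>2) \<partial>law t) + 1"
    by (simp add: ennreal_plus nn_integral_add emeasure_space_1)
  finally show ?thesis .
qed

lemma second_moment_fixed_arm_le:
  assumes arm: "\<And>s h. s \<in> S \<Longrightarrow> h \<in> space (histories s) \<Longrightarrow> A s h = return M a"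
    and a: "a \<in> space M"
  shows "(\<integral>\<^sup>+h. ennreal ((\<Sum>s\<in>S \<inter> {..<t}. snd (h s) - \<mu> a)\<^sup>2) \<partial>law t) \<le> ennreal (card (S \<inter> {..<t}))"
proof (induction t)
  case 0
  then show ?case by simp
next
  case (Suc t)
  define Z where "Z h = (\<Sum>s\<in>S \<inter> {..<t}. snd (h s) - \<mu> a)" for h :: "nat \<Rightarrow> 'a \<times> real"
  have Z: "Z \<in> borel_measurable (histories t)"
    unfolding Z_def[abs_def] by simp
  have past: "Z (restrict h {0..<t}) = Z h" for h
    by (simp add: Z_def)
  show ?case
  proof (cases "t \<in> S")
    case False
    then have "S \<inter> {..<Suc t} = S \<inter> {..<t}" by (auto simp: less_Suc_eq)
    moreover have "(\<integral>\<^sup>+h. ennreal ((Z h)\<^sup>2) \<partial>law (Suc t)) = (\<integral>\<^sup>+h. ennreal ((Z h)\<^sup>2) \<partial>law t)"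
      using nn_integral_law_restrict[of t "Suc t" "\<lambda>h. ennreal ((Z h)\<^sup>2)"] Z by (simp add: past)
    ultimately show ?thesis using Suc by (simp add: Z_def)
  next
    case True
    then have rounds: "S \<inter> {..<Suc t} = insert t (S \<inter> {..<t})" by (auto simp: less_Suc_eq)
    have "(\<integral>\<^sup>+h. ennreal ((Z h + (snd (h t) - \<mu> a))\<^sup>2) \<partial>law (Suc t)) \<le>
        (\<integral>\<^sup>+h. ennreal ((Z h)\<^sup>2) \<partial>law t) + 1"
      using second_moment_Suc_le[OF arm a Z] True by (simp add: past)
    also have "\<dots> \<le> ennreal (card (S \<inter> {..<t})) + 1"
      using Suc by (intro add_right_mono) (simp add: Z_def)
    finally show ?thesis
      unfolding rounds by (simp add: Z_def add.commute)
  qed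
qed

lemma empirical_mean_error_le:
  assumes S: "S \<subseteq> {..<t}" "S \<noteq> {}" and a: "a \<in> space M"
    and arm: "\<And>s h. s \<in> S \<Longrightarrow> h \<in> space (histories s) \<Longrightarrow> A s h = return M a"
  shows "integrable (law t) (\<lambda>h. empirical_mean S h - \<mu> a)"
    and "(\<integral>h. \<bar>empirical_mean S h - \<mu> a\<bar> \<partial>law t) \<le> 1 / sqrt (card S)"
proof -
  interpret prob_space "law t" by (rule prob_space_law)
  define Z where "Z h = (\<Sum>s\<in>S. snd (h s) - \<mu> a)" for h :: "nat \<Rightarrow> 'a \<times> real"
  have finite: "finite S" using S(1) finite_subset by blast
  then have card_pos: "0 < real (card S)" using S(2) by (simp add: card_gt_0_iff)
  have error: "empirical_mean S h - \<mu> a = Z h / real (card S)" for h :: "nat \<Rightarrow> 'a \<times> real"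
    using card_pos by (simp add: Z_def empirical_mean_def sum_subtractf field_simps)
  have Z: "Z \<in> borel_measurable (law t)"
    unfolding Z_def[abs_def] using S(1)
    by (intro borel_measurable_sum borel_measurable_diff) (auto cong: measurable_cong_sets)
  have second_moment: "(\<integral>\<^sup>+h. ennreal ((Z h)\<^sup>2) \<partial>law t) \<le> ennreal (card S)"
    using second_moment_fixed_arm_le[OF arm a, of S t] S(1) by (simp add: Z_def Int_absorb2)
  then have "(\<integral>\<^sup>+h. ennreal ((Z h)\<^sup>2) \<partial>law t) < \<infinity>"
    by (rule le_less_trans) simp
  then have Z_square: "integrable (law t) (\<lambda>h. (Z h)\<^sup>2)"
    using Z by (intro integrableI_nonneg) auto
  show "integrable (law t) (\<lambda>h. empirical_mean S h - \<mu> a)"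
    unfolding error using square_integrable_imp_integrable[OF Z Z_square] by simp
  have "expectation (\<lambda>h. (Z h)\<^sup>2) \<le> real (card S)"
    using second_moment by (simp add: nn_integral_eq_integral[OF Z_square])
  then have "expectation (\<lambda>h. \<bar>Z h\<bar>) \<le> sqrt (real (card S))"
    using expectation_abs_le_sqrt_second_moment[OF Z Z_square] by (meson order_trans real_sqrt_le_iff)
  then have "expectation (\<lambda>h. \<bar>Z h\<bar>) / real (card S) \<le> sqrt (real (card S)) / real (card S)"
    using card_pos by (simp add: divide_right_mono)
  then show "(\<integral>h. \<bar>empirical_mean S h - \<mu> a\<bar> \<partial>law t) \<le> 1 / sqrt (card S)"
    unfolding error by (simp add: abs_divide sqrt_divide_self_eq inverse_eq_divide)
qed

end

section \<open>Explore and exploit\<close>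

definition exploration_schedule :: "nat \<Rightarrow> nat option" where
  "exploration_schedule s =
     (if (floor_sqrt s)\<^sup>2 = s then Some (fst (prod_decode (floor_sqrt s))) else None)"

definition exploration_rounds :: "nat \<Rightarrow> nat \<Rightarrow> nat set" where
  "exploration_rounds i t = {s. s < t \<and> exploration_schedule s = Some i}"

lemma infinite_exploration_rounds: "infinite {s. exploration_schedule s = Some i}"
proof -
  have "inj (\<lambda>j. (prod_encode (i, j))\<^sup>2)"
    by (auto simp: inj_def)
  moreover have "range (\<lambda>j. (prod_encode (i, j))\<^sup>2) \<subseteq> {s. exploration_schedule s = Some i}"
    by (auto simp: exploration_schedule_def)
  ultimately show ?thesis
    using range_inj_infinite infinite_super by blast
qed

lemma card_exploration_rounds_at_top:
  "filterlim (\<lambda>t. card (exploration_rounds i t)) at_top sequentially"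
  unfolding filterlim_at_top
proof
  fix m
  obtain B where rounds: "finite B" "card B = m" "B \<subseteq> {s. exploration_schedule s = Some i}"
    using infinite_arbitrarily_large[OF infinite_exploration_rounds] by blast
  then obtain T where "B \<subseteq> {..<T}" using finite_nat_bounded by blast
  then have "m \<le> card (exploration_rounds i t)" if "t \<ge> T" for t
    unfolding rounds(2)[symmetric] using rounds(3) that
    by (intro card_mono) (auto simp: exploration_rounds_def)
  then show "\<forall>\<^sub>F t in sequentially. m \<le> card (exploration_rounds i t)"
    using eventually_sequentially by blast
qed

lemma exploration_rounds_sparse:
  "(\<lambda>t. real (card {s. s < t \<and> exploration_schedule s \<noteq> None}) / real t) \<longlonglongrightarrow> 0"
proof (rule Lim_null_comparison)
  have "real (card {s. s < t \<and> exploration_schedule s \<noteq> None}) \<le> sqrt (real t) + 1" for t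
  proof -
    have "{s. s < t \<and> exploration_schedule s \<noteq> None} \<subseteq> (\<lambda>n. n\<^sup>2) ` {..floor_sqrt t}"
    proof
      fix s assume "s \<in> {s. s < t \<and> exploration_schedule s \<noteq> None}"
      then have "s < t" "s = (floor_sqrt s)\<^sup>2"
        by (auto simp: exploration_schedule_def split: if_splits)
      then show "s \<in> (\<lambda>n. n\<^sup>2) ` {..floor_sqrt t}"
        using monoD[OF mono_floor_sqrt, of s t] by auto
    qed
    then have "card {s. s < t \<and> exploration_schedule s \<noteq> None} \<le> card {..floor_sqrt t}"
      by (intro surj_card_le) auto
    then have "real (card {s. s < t \<and> exploration_schedule s \<noteq> None}) \<le> real (floor_sqrt t) + 1"
      by simp
    also have "real (floor_sqrt t) \<le> sqrt (real t)"
      by (rule real_le_rsqrt) (metis floor_sqrt_power2_le of_nat_le_iff of_nat_power)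
    finally show ?thesis by simp
  qed
  then show "\<forall>\<^sub>F t in sequentially.
      norm (real (card {s. s < t \<and> exploration_schedule s \<noteq> None}) / real t)
      \<le> (sqrt (real t) + 1) / real t"
    by (intro always_eventually) (auto intro!: divide_right_mono)
  show "(\<lambda>t. (sqrt (real t) + 1) / real t) \<longlonglongrightarrow> 0"
    by real_asymp
qed

lemma cesaro_null:
  fixes b :: "nat \<Rightarrow> real"
  assumes "b \<longlonglongrightarrow> 0"
  shows "(\<lambda>t. (\<Sum>s<t. b s) / real t) \<longlonglongrightarrow> 0"
proof (rule LIMSEQ_I)
  fix e :: real assume e_pos: "e > 0"
  obtain n where tail_small: "\<And>s. s \<ge> n \<Longrightarrow> \<bar>b s\<bar> \<le> e / 2"
    using LIMSEQ_D[OF assms, of "e/2"] e_pos by (auto intro: less_imp_le)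
  define c where "c = (\<Sum>s<n. \<bar>b s\<bar>)"
  have sum_le: "\<bar>\<Sum>s<t. b s\<bar> \<le> c + real t * (e / 2)" if "n \<le> t" for t
  proof -
    have "\<bar>\<Sum>s<t. b s\<bar> \<le> (\<Sum>s<t. \<bar>b s\<bar>)" by (rule sum_abs)
    also have "\<dots> = c + (\<Sum>s=n..<t. \<bar>b s\<bar>)"
      using sum.atLeastLessThan_concat[of 0 n t "\<lambda>s. \<bar>b s\<bar>"] that by (simp add: c_def atLeast0LessThan)
    also have "\<dots> \<le> c + (\<Sum>s=n..<t. e / 2)"
      by (intro add_left_mono sum_mono tail_small) simp
    also have "\<dots> \<le> c + real t * (e / 2)"
      using e_pos by simp
    finally show ?thesis .
  qed
  obtain m where m_large: "2 * c / e < real m" using reals_Archimedean2 by blast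
  have "\<bar>(\<Sum>s<t. b s) / real t\<bar> < e" if "t \<ge> Suc (max m n)" for t
  proof -
    have "2 * c / e < real t" using m_large that by linarith
    then have "c < real t * (e / 2)" using e_pos by (simp add: field_simps)
    moreover have "\<bar>\<Sum>s<t. b s\<bar> \<le> c + real t * (e / 2)" using that by (intro sum_le) simp
    ultimately have "\<bar>\<Sum>s<t. b s\<bar> < e * real t" by (simp add: mult.commute[of e])
    then show ?thesis using that by (simp add: abs_divide pos_divide_less_eq)
  qed
  then show "\<exists>m. \<forall>t\<ge>m. norm ((\<Sum>s<t. b s) / real t - 0) < e"
    by (intro exI[of _ "Suc (max m n)"]) simp
qed

definition explore_exploit_rate :: "(nat \<Rightarrow> real) \<Rightarrow> nat \<Rightarrow> real" where
  "explore_exploit_rate \<epsilon> t = (\<Sum>s<t. of_bool (exploration_schedule s \<noteq> None) + 3 * \<epsilon> s)"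

lemma explore_exploit_rate_sublinear:
  assumes "\<epsilon> \<longlonglongrightarrow> 0"
  shows "(\<lambda>t. explore_exploit_rate \<epsilon> t / real t) \<longlonglongrightarrow> 0"
proof -
  have "(\<lambda>s. 3 * \<epsilon> s) \<longlonglongrightarrow> 0"
    using tendsto_mult_left[OF assms, of 3] by simp
  from tendsto_add[OF exploration_rounds_sparse cesaro_null[OF this]]
  show ?thesis
    by (simp add: explore_exploit_rate_def sum.distrib add_divide_distrib of_bool_def
        sum.If_cases Int_def)
qed

definition best_estimate :: "nat \<Rightarrow> nat \<Rightarrow> (nat \<Rightarrow> 'a \<times> real) \<Rightarrow> nat" where
  "best_estimate n t h = (LEAST i. i < n \<and>
     (\<forall>j<n. empirical_mean (exploration_rounds j t) h \<le> empirical_mean (exploration_rounds i t) h))"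

definition explore_exploit_arm :: "(nat \<Rightarrow> 'a) \<Rightarrow> (nat \<Rightarrow> nat) \<Rightarrow> nat \<Rightarrow> (nat \<Rightarrow> 'a \<times> real) \<Rightarrow> 'a" where
  "explore_exploit_arm a n t h =
     a (case exploration_schedule t of Some i \<Rightarrow> i | None \<Rightarrow> best_estimate (n t) t h)"

lemma best_estimate_maximizes:
  assumes "n > 0"
  shows "best_estimate n t h < n"
    and "j < n \<Longrightarrow> empirical_mean (exploration_rounds j t) h
           \<le> empirical_mean (exploration_rounds (best_estimate n t h) t) h"
proof -
  let ?m = "\<lambda>i. empirical_mean (exploration_rounds i t) h"
  obtain i where "i \<in> {..<n}" "Max (?m ` {..<n}) = ?m i"
    using obtains_MAX[of "{..<n}" ?m] assms by auto
  then have "i < n \<and> (\<forall>j<n. ?m j \<le> ?m i)"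
    by (metis Max_ge finite_imageI finite_lessThan imageI lessThan_iff)
  from LeastI[of "\<lambda>i. i < n \<and> (\<forall>j<n. ?m j \<le> ?m i)", OF this]
  show "best_estimate n t h < n" "j < n \<Longrightarrow> ?m j \<le> ?m (best_estimate n t h)"
    by (auto simp: best_estimate_def)
qed

lemma measurable_best_estimate:
  "best_estimate n t \<in> PiM {0..<t} (\<lambda>_. M \<Otimes>\<^sub>M borel) \<rightarrow>\<^sub>M count_space UNIV"
proof -
  let ?H = "PiM {0..<t} (\<lambda>_. M \<Otimes>\<^sub>M borel)"
  let ?m = "\<lambda>i. empirical_mean (exploration_rounds i t)"
  have "?m i \<in> borel_measurable ?H" for i
    by (rule measurable_empirical_mean) (auto simp: exploration_rounds_def)
  then have "Measurable.pred ?H (\<lambda>h. i < n \<and> (\<forall>j\<in>{..<n}. ?m j h \<le> ?m i h))" for i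
    by (intro pred_intros_logic pred_intros_finite) (auto simp: pred_def intro!: borel_measurable_le)
  then show ?thesis
    unfolding best_estimate_def[abs_def] lessThan_iff Ball_def by (rule measurable_Least)
qed

lemma measurable_explore_exploit_arm:
  assumes "range a \<subseteq> space M"
  shows "explore_exploit_arm a n t \<in> PiM {0..<t} (\<lambda>_. M \<Otimes>\<^sub>M borel) \<rightarrow>\<^sub>M M"
proof -
  have "a \<in> count_space UNIV \<rightarrow>\<^sub>M M" using assms by auto
  then show ?thesis
    unfolding explore_exploit_arm_def[abs_def]
    by (cases "exploration_schedule t")
      (auto simp: image_subset_iff
        intro: measurable_compose[OF measurable_best_estimate] measurable_const)
qed

lemma bandit_algorithm_explore_exploit:
  "range a \<subseteq> space M \<Longrightarrow> bandit_algorithm M (\<lambda>t h. return M (explore_exploit_arm a n t h))"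
  unfolding bandit_algorithm_def
  by (intro allI measurable_compose[OF measurable_explore_exploit_arm measurable_return_prob_space])

lemma Sup_minus_best_estimate_le:
  fixes \<mu> :: "'a \<Rightarrow> real" and m :: "nat \<Rightarrow> real"
  assumes "X \<noteq> {}" and net: "\<And>y. y \<in> X \<Longrightarrow> \<exists>j<n. \<mu> y \<le> \<mu> (a j) + \<epsilon>"
    and best: "b < n" "\<And>j. j < n \<Longrightarrow> m j \<le> m b"
  shows "(SUP x\<in>X. \<mu> x) - \<mu> (a b) \<le> \<epsilon> + 2 * (\<Sum>i<n. \<bar>m i - \<mu> (a i)\<bar>)"
proof -
  have error: "\<bar>m j - \<mu> (a j)\<bar> \<le> (\<Sum>i<n. \<bar>m i - \<mu> (a i)\<bar>)" if "j < n" for j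
    using that by (intro member_le_sum) auto
  have "(SUP x\<in>X. \<mu> x) \<le> \<mu> (a b) + \<epsilon> + 2 * (\<Sum>i<n. \<bar>m i - \<mu> (a i)\<bar>)"
  proof (rule cSUP_least[OF \<open>X \<noteq> {}\<close>])
    fix y assume "y \<in> X"
    then obtain j where near: "j < n" "\<mu> y \<le> \<mu> (a j) + \<epsilon>" using net by blast
    then show "\<mu> y \<le> \<mu> (a b) + \<epsilon> + 2 * (\<Sum>i<n. \<bar>m i - \<mu> (a i)\<bar>)"
      using best(2)[OF near(1)] error[OF near(1)] error[OF best(1)] by linarith
  qed
  then show ?thesis by simp
qed

locale explore_exploit = bandit_instance M "\<lambda>t h. return M (explore_exploit_arm a n t h)" \<nu> \<mu>
  for M :: "'a measure" and a :: "nat \<Rightarrow> 'a" and n :: "nat \<Rightarrow> nat" and \<nu> \<mu> +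
  assumes candidates: "range a \<subseteq> space M"
begin

lemma arm_measurable [measurable]: "explore_exploit_arm a n t \<in> histories t \<rightarrow>\<^sub>M M"
  by (rule measurable_explore_exploit_arm[OF candidates])

lemma candidate_error_le:
  fixes m :: real
  assumes "0 < m" and explored: "m\<^sup>2 \<le> card (exploration_rounds i t)"
  shows "integrable (law t) (\<lambda>h. empirical_mean (exploration_rounds i t) h - \<mu> (a i))"
    and "(\<integral>h. \<bar>empirical_mean (exploration_rounds i t) h - \<mu> (a i)\<bar> \<partial>law t) \<le> 1 / m"
proof -
  have rounds: "exploration_rounds i t \<subseteq> {..<t}" and a: "a i \<in> space M"
    using candidates by (auto simp: exploration_rounds_def)
  have nonempty: "exploration_rounds i t \<noteq> {}"
    using explored \<open>0 < m\<close> by force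
  have arm: "explore_exploit_arm a n s h = a i" if "s \<in> exploration_rounds i t" for s h
    using that by (simp add: exploration_rounds_def explore_exploit_arm_def)
  show "integrable (law t) (\<lambda>h. empirical_mean (exploration_rounds i t) h - \<mu> (a i))"
    by (rule empirical_mean_error_le(1)[OF rounds nonempty a]) (simp add: arm)
  have "(\<integral>h. \<bar>empirical_mean (exploration_rounds i t) h - \<mu> (a i)\<bar> \<partial>law t)
      \<le> 1 / sqrt (card (exploration_rounds i t))"
    by (rule empirical_mean_error_le(2)[OF rounds nonempty a]) (simp add: arm)
  also have "\<dots> \<le> 1 / m"
    using \<open>0 < m\<close> real_le_rsqrt[OF explored] by (intro frac_le) auto
  finally show "(\<integral>h. \<bar>empirical_mean (exploration_rounds i t) h - \<mu> (a i)\<bar> \<partial>law t) \<le> 1 / m" .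
qed

lemma expected_exploitation_gap_le:
  assumes exploiting: "exploration_schedule t = None" and \<epsilon>_pos: "0 < \<epsilon>"
    and net: "\<And>y. y \<in> space M \<Longrightarrow> \<exists>i<n t. \<mu> y \<le> \<mu> (a i) + \<epsilon>"
    and explored: "\<And>i. i < n t \<Longrightarrow> (real (n t) / \<epsilon>)\<^sup>2 \<le> card (exploration_rounds i t)"
  shows "(\<integral>h. gap (explore_exploit_arm a n t h) \<partial>law t) \<le> 3 * \<epsilon>"
proof -
  interpret prob_space "law t" by (rule prob_space_law)
  define error where "error i h = empirical_mean (exploration_rounds i t) h - \<mu> (a i)"
    for i and h :: "nat \<Rightarrow> 'a \<times> real"
  have n_pos: "0 < n t" using net arms_nonempty by fastforce
  have gap_le: "gap (explore_exploit_arm a n t h) \<le> \<epsilon> + 2 * (\<Sum>i<n t. \<bar>error i h\<bar>)" for h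
    unfolding error_def gap_def explore_exploit_arm_def exploiting option.case
    by (intro Sup_minus_best_estimate_le arms_nonempty net best_estimate_maximizes n_pos)
  have "0 < real (n t) / \<epsilon>" using n_pos \<epsilon>_pos by simp
  note error_bounds = candidate_error_le[OF this explored, folded error_def]
  have abs_integrable: "integrable (law t) (\<lambda>h. \<bar>error i h\<bar>)" if "i < n t" for i
    by (rule integrable_abs[OF error_bounds(1)[OF that]])
  have sum_integrable: "integrable (law t) (\<lambda>h. \<Sum>i<n t. \<bar>error i h\<bar>)"
    by (rule Bochner_Integration.integrable_sum) (simp add: abs_integrable)
  have "(\<integral>h. gap (explore_exploit_arm a n t h) \<partial>law t) \<le> (\<integral>h. \<epsilon> + 2 * (\<Sum>i<n t. \<bar>error i h\<bar>) \<partial>law t)"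
    by (rule integral_mono[OF integrable_gap[OF prob_space_law] _ gap_le]) (simp_all add: sum_integrable)
  also have "\<dots> = \<epsilon> + 2 * (\<Sum>i<n t. expectation (\<lambda>h. \<bar>error i h\<bar>))"
    using sum_integrable abs_integrable by (simp add: prob_space integral_sum)
  also have "\<dots> \<le> \<epsilon> + 2 * (\<Sum>i<n t. \<epsilon> / n t)"
    using error_bounds(2) by (intro add_left_mono mult_left_mono sum_mono) auto
  also have "\<dots> = 3 * \<epsilon>" using n_pos by simp
  finally show ?thesis .
qed

lemma regret_le_explore_exploit_rate:
  assumes \<epsilon>_pos: "\<And>s. 0 < \<epsilon> s"
    and accuracy: "\<And>s. 1 \<le> \<epsilon> s \<or>
      (\<forall>y\<in>space M. \<exists>i<n s. \<mu> y \<le> \<mu> (a i) + \<epsilon> s) \<and>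
      (\<forall>i<n s. (real (n s) / \<epsilon> s)\<^sup>2 \<le> card (exploration_rounds i s))"
  shows "regret M (\<lambda>t h. return M (explore_exploit_arm a n t h)) \<mu> \<nu> t
    \<le> explore_exploit_rate \<epsilon> t"
  unfolding regret_eq_sum explore_exploit_rate_def
proof (rule sum_mono)
  fix s
  have "(\<integral>x. gap x \<partial>(law s \<bind> (\<lambda>h. return M (explore_exploit_arm a n s h)))) =
      (\<integral>h. gap (explore_exploit_arm a n s h) \<partial>law s)"
    by (subst bind_return_distr') (auto simp: prob_space.not_empty[OF prob_space_law] integral_distr)
  also have "\<dots> \<le> of_bool (exploration_schedule s \<noteq> None) + 3 * \<epsilon> s"
  proof (cases "exploration_schedule s = None \<and> \<epsilon> s < 1")
    case True
    then show ?thesis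
      using expected_exploitation_gap_le[of s "\<epsilon> s"] accuracy[of s] \<epsilon>_pos[of s] by auto
  next
    case False
    then have "1 \<le> of_bool (exploration_schedule s \<noteq> None) + 3 * \<epsilon> s"
      using \<epsilon>_pos[of s] by auto
    with expected_gap_le_1[OF prob_space_law, of "explore_exploit_arm a n s" s]
    show ?thesis by simp
  qed
  finally show "(\<integral>x. gap x \<partial>(law s \<bind> (\<lambda>h. return M (explore_exploit_arm a n s h))))
    \<le> of_bool (exploration_schedule s \<noteq> None) + 3 * \<epsilon> s" .
qed

end

section \<open>Avoided sets of arms\<close>

definition avoiding :: "'a measure \<Rightarrow> 'a set \<Rightarrow> nat \<Rightarrow> (nat \<Rightarrow> 'a \<times> real) set" where
  "avoiding M V t = {h \<in> space (PiM {0..<t} (\<lambda>_. M \<Otimes>\<^sub>M borel)). \<forall>s<t. fst (h s) \<notin> V}"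

lemma sets_avoiding:
  assumes V: "V \<in> sets M"
  shows "avoiding M V t \<in> sets (PiM {0..<t} (\<lambda>_. M \<Otimes>\<^sub>M borel))"
proof -
  let ?H = "PiM {0..<t} (\<lambda>_. M \<Otimes>\<^sub>M borel) :: (nat \<Rightarrow> 'a \<times> real) measure"
  have "avoiding M V t = space ?H - (\<Union>s\<in>{..<t}. (\<lambda>h. fst (h s)) -` V \<inter> space ?H)"
    by (auto simp: avoiding_def)
  also have "\<dots> \<in> sets ?H"
    using measurable_sets[OF measurable_round_arm V] by (intro sets.Diff sets.top sets.finite_UN) auto
  finally show ?thesis .
qed

lemma (in bandit_run) prob_avoiding_tendsto_1:
  assumes V: "\<And>k. V k \<in> sets M" "decseq V" "(\<Inter>k. V k) = {}"
  shows "(\<lambda>k. measure (law t) (avoiding M (V k) t)) \<longlonglongrightarrow> 1"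
proof -
  interpret prob_space "law t" by (rule prob_space_law)
  have "incseq (\<lambda>k. avoiding M (V k) t)"
    using decseqD[OF V(2)] by (fastforce simp: incseq_def avoiding_def)
  moreover have "(\<Union>k. avoiding M (V k) t) = space (law t)"
  proof
    show "space (law t) \<subseteq> (\<Union>k. avoiding M (V k) t)"
    proof
      fix h assume h: "h \<in> space (law t)"
      have "\<forall>\<^sub>F k in sequentially. fst (h s) \<notin> V k" for s
      proof -
        obtain k where "fst (h s) \<notin> V k" using V(3) by blast
        then have "fst (h s) \<notin> V k'" if "k \<le> k'" for k'
          using decseqD[OF V(2) that] by blast
        then show ?thesis by (auto simp: eventually_sequentially)
      qed
      then have "\<forall>\<^sub>F k in sequentially. \<forall>s\<in>{..<t}. fst (h s) \<notin> V k"
        by (intro eventually_ball_finite) auto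
      then show "h \<in> (\<Union>k. avoiding M (V k) t)"
        using h by (auto simp: avoiding_def space_law eventually_sequentially)
    qed
  qed (auto simp: avoiding_def space_law)
  ultimately show ?thesis
    using finite_Lim_measure_incseq[of "\<lambda>k. avoiding M (V k) t"] sets_avoiding[OF V(1)]
    by (simp add: image_subset_iff prob_space)
qed

lemma (in bandit_instance) regret_ge_avoiding:
  assumes V: "V \<in> sets M" and gap: "\<And>x. x \<in> space M - V \<Longrightarrow> g \<le> gap x"
  shows "real t * g * measure (law t) (avoiding M V t) \<le> regret M A \<mu> \<nu> t"
proof -
  interpret prob_space "law t" by (rule prob_space_law)
  have avoiding: "avoiding M V t \<in> events"
    using sets_avoiding[OF V] by simp
  have integrable: "integrable (law t) (indicat_real (avoiding M V t))"
    by (rule integrable_real_indicator[OF avoiding]) (simp add: emeasure_eq_measure)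
  have "real t * g * indicator (avoiding M V t) h \<le> (\<Sum>s<t. gap (fst (h s)))"
    if h: "h \<in> space (law t)" for h
  proof (cases "h \<in> avoiding M V t")
    case True
    then show ?thesis
      using sum_bounded_below[of "{..<t}" g "\<lambda>s. gap (fst (h s))"] gap round_arm_in[OF h]
      by (simp add: avoiding_def)
  next
    case False
    then show ?thesis
      by (auto intro!: sum_nonneg gap_nonneg round_arm_in[OF h])
  qed
  then have "(\<integral>h. real t * g * indicator (avoiding M V t) h \<partial>law t) \<le>
      (\<integral>h. (\<Sum>s<t. gap (fst (h s))) \<partial>law t)"
    by (intro integral_mono Bochner_Integration.integrable_sum integrable_gap prob_space_law
        integrable_mult_right integrable) auto
  then show ?thesis
    using sets.sets_into_space[OF avoiding] by (simp add: regret_eq_expected_gaps Int_absorb2)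
qed

text \<open>The weight \<open>F\<close> makes the induction work: undoing one round replaces it by a
  conditional expectation.\<close>

lemma nn_integral_law_cong_avoiding:
  assumes "bandit_run M A \<nu>" "bandit_run M A \<nu>'" and eq: "\<And>x. x \<in> space M - V \<Longrightarrow> \<nu> x = \<nu>' x"
    and "F \<in> borel_measurable (PiM {0..<t} (\<lambda>_. M \<Otimes>\<^sub>M borel))"
    and "\<And>h. h \<in> space (PiM {0..<t} (\<lambda>_. M \<Otimes>\<^sub>M borel)) - avoiding M V t \<Longrightarrow> F h = 0"
  shows "(\<integral>\<^sup>+h. F h \<partial>history_law M A \<nu> t) = (\<integral>\<^sup>+h. F h \<partial>history_law M A \<nu>' t)"
  using assms(4,5)
proof (induction t arbitrary: F)
  case 0
  then show ?case by (simp add: bandit_run.law_0[OF assms(1)] bandit_run.law_0[OF assms(2)])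
next
  case (Suc t)
  interpret B: bandit_run M A \<nu> by fact
  interpret B': bandit_run M A \<nu>' by fact
  let ?G = "\<lambda>\<nu> h. \<integral>\<^sup>+x. \<integral>\<^sup>+y. F (h(t := (x, y))) \<partial>\<nu> x \<partial>A t h"
  have visited: "F (h(t := (x, y))) = 0"
    if "h \<in> space (B.histories t)" "x \<in> space M" "h \<notin> avoiding M V t \<or> x \<in> V" for h x y
    using that by (intro Suc.prems(2) DiffI B.extend_history_in) (auto simp: avoiding_def less_Suc_eq)
  have round: "?G \<nu> h = ?G \<nu>' h" if h: "h \<in> space (B.histories t)" for h
  proof (rule nn_integral_cong)
    fix x assume "x \<in> space (A t h)"
    then have "x \<in> space M" by (simp add: B.space_algorithm[OF h])
    then show "(\<integral>\<^sup>+y. F (h(t := (x, y))) \<partial>\<nu> x) = (\<integral>\<^sup>+y. F (h(t := (x, y))) \<partial>\<nu>' x)"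
      using eq[of x] visited[OF h] by (cases "x \<in> V") simp_all
  qed
  have "?G \<nu> h = 0" if h: "h \<in> space (B.histories t) - avoiding M V t" for h
  proof -
    have "?G \<nu> h = (\<integral>\<^sup>+x. 0 \<partial>A t h)"
      using h by (intro nn_integral_cong) (simp add: visited B.space_algorithm)
    then show ?thesis by simp
  qed
  then have "(\<integral>\<^sup>+h. ?G \<nu> h \<partial>B.law t) = (\<integral>\<^sup>+h. ?G \<nu> h \<partial>B'.law t)"
    by (intro Suc.IH B.measurable_round_integral Suc.prems(1))
  also have "\<dots> = (\<integral>\<^sup>+h. ?G \<nu>' h \<partial>B'.law t)"
    by (intro nn_integral_cong round) (simp add: B'.space_law)
  finally show ?case
    by (simp only: B.nn_integral_law_Suc[OF Suc.prems(1)] B'.nn_integral_law_Suc[OF Suc.prems(1)])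
qed

lemma prob_avoiding_cong:
  assumes "bandit_run M A \<nu>" "bandit_run M A \<nu>'" and V: "V \<in> sets M"
    and eq: "\<And>x. x \<in> space M - V \<Longrightarrow> \<nu> x = \<nu>' x"
  shows "measure (history_law M A \<nu> t) (avoiding M V t) =
    measure (history_law M A \<nu>' t) (avoiding M V t)"
proof -
  have "(\<integral>\<^sup>+h. indicator (avoiding M V t) h \<partial>history_law M A \<nu> t) =
      (\<integral>\<^sup>+h. indicator (avoiding M V t) h \<partial>history_law M A \<nu>' t)"
    using sets_avoiding[OF V] by (intro nn_integral_law_cong_avoiding[OF assms(1,2) eq]) auto
  then show ?thesis
    using sets_avoiding[OF V] bandit_run.sets_law[OF assms(1)] bandit_run.sets_law[OF assms(2)]
    by (simp add: measure_def)
qed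

section \<open>Hidden needles\<close>

definition needles :: "('a \<Rightarrow> 'a \<Rightarrow> real) \<Rightarrow> (nat \<Rightarrow> 'a) \<Rightarrow> (nat \<Rightarrow> real) \<Rightarrow> nat set \<Rightarrow> 'a \<Rightarrow> real" where
  "needles D a c L x = Sup (insert 0 ((\<lambda>l. c l - D x (a l)) ` L))"

locale needle_family = Metric_space X D for X :: "'a set" and D +
  fixes a :: "nat \<Rightarrow> 'a" and c :: "nat \<Rightarrow> real"
  assumes centers: "range a \<subseteq> X" and heights: "\<And>l. c l \<le> 1"
begin

lemma needle_le_1: "c l - D x (a l) \<le> 1"
  using heights[of l] nonneg[of x "a l"] by linarith

lemma bdd_above_needles: "bdd_above (insert 0 ((\<lambda>l. c l - D x (a l)) ` L))"
  using needle_le_1 by (intro bdd_aboveI[of _ 1]) auto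

lemma needles_nonneg: "0 \<le> needles D a c L x"
  unfolding needles_def by (intro cSup_upper bdd_above_needles) simp

lemma needle_le_needles: "l \<in> L \<Longrightarrow> c l - D x (a l) \<le> needles D a c L x"
  unfolding needles_def by (intro cSup_upper bdd_above_needles) simp

lemma needles_least: "0 \<le> z \<Longrightarrow> (\<And>l. l \<in> L \<Longrightarrow> c l - D x (a l) \<le> z) \<Longrightarrow> needles D a c L x \<le> z"
  unfolding needles_def by (intro cSup_least) auto

lemma needles_le_1: "needles D a c L x \<le> 1"
  by (intro needles_least needle_le_1) simp

lemma needles_Lipschitz:
  assumes "x \<in> X" "y \<in> X"
  shows "\<bar>needles D a c L x - needles D a c L y\<bar> \<le> D x y"
proof -
  have one_sided: "needles D a c L x \<le> needles D a c L y + D x y" if "x \<in> X" "y \<in> X" for x y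
  proof (rule needles_least)
    show "0 \<le> needles D a c L y + D x y" using needles_nonneg by simp
    fix l assume "l \<in> L"
    moreover have "D y (a l) \<le> D x y + D x (a l)"
      using triangle[of y x "a l"] centers that commute[of x y] by auto
    ultimately show "c l - D x (a l) \<le> needles D a c L y + D x y"
      using needle_le_needles[of l L y] by simp
  qed
  show ?thesis
    using one_sided[OF assms] one_sided[OF assms(2,1)] commute[of x y] by simp
qed

lemma lipschitz_mab_instance_needles:
  assumes arms: "arm_space X D M"
  shows "lipschitz_mab_instance X D M (needles D a c L) (\<lambda>x. return borel (needles D a c L x))"
proof -
  have "needles D a c L \<in> borel_measurable M"
    by (rule measurable_if_Lipschitz[OF Metric_space_axioms arms needles_Lipschitz])
  then have "(\<lambda>x. return borel (needles D a c L x)) \<in> M \<rightarrow>\<^sub>M prob_algebra borel"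
    by (rule measurable_compose[OF _ measurable_return_prob_space])
  then show ?thesis
    using needles_Lipschitz needles_nonneg needles_le_1
    by (auto simp: lipschitz_mab_instance_def integral_return)
qed

lemma needles_eq_if_out_of_reach:
  assumes "L \<subseteq> L'" and "\<And>l. l \<in> L' - L \<Longrightarrow> c l \<le> D x (a l)"
  shows "needles D a c L' x = needles D a c L x"
proof (rule antisym)
  show "needles D a c L' x \<le> needles D a c L x"
  proof (rule needles_least[OF needles_nonneg])
    fix l assume "l \<in> L'"
    then show "c l - D x (a l) \<le> needles D a c L x"
      using assms(2)[of l] needle_le_needles[of l L x] needles_nonneg[of L x] by fastforce
  qed
  show "needles D a c L x \<le> needles D a c L' x"
    using assms(1) by (intro needles_least needles_nonneg needle_le_needles) auto
qed

end

locale hidden_needles = Metric_space X D for X :: "'a set" and D +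
  fixes M :: "'a measure" and A :: "nat \<Rightarrow> (nat \<Rightarrow> 'a \<times> real) \<Rightarrow> 'a measure"
    and a :: "nat \<Rightarrow> 'a" and r :: real
  assumes arms: "arm_space X D M" and algorithm: "bandit_algorithm M A"
    and radius: "0 < r" "r \<le> 1" and centers: "range a \<subseteq> X"
    and separated: "\<And>i j. i \<noteq> j \<Longrightarrow> 2 * r \<le> D (a i) (a j)"
begin

definition height :: "nat \<Rightarrow> real" where
  "height l = r * (1 - (1/2) ^ Suc l)"

text \<open>Needle \<open>l\<close> sits at the centre \<open>a (p l)\<close>; only the needles in \<open>L\<close> are present.\<close>

definition payoff :: "(nat \<Rightarrow> nat) \<Rightarrow> nat set \<Rightarrow> 'a \<Rightarrow> real" where
  "payoff p L = needles D (a \<circ> p) height L"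

definition reward :: "(nat \<Rightarrow> nat) \<Rightarrow> nat set \<Rightarrow> 'a \<Rightarrow> real measure" where
  "reward p L x = return borel (payoff p L x)"

definition tail :: "nat \<Rightarrow> 'a set" where
  "tail k = (\<Union>i\<in>{k..}. mball (a i) r)"

lemma space_M: "space M = X"
  using arms by (simp add: arm_space_def)

lemma height_le: "height l \<le> r"
  using radius by (simp add: height_def mult_le_cancel_left1)

lemma height_le_if_less: "l < j \<Longrightarrow> height l \<le> r * (1 - (1/2) ^ j)"
  unfolding height_def using radius by (intro mult_left_mono diff_left_mono power_decreasing) auto

lemma needle_family: "needle_family X D (a \<circ> p) height"
  using centers height_le radius by unfold_locales (auto intro: order_trans)

lemma lipschitz_mab_instance_payoff: "lipschitz_mab_instance X D M (payoff p L) (reward p L)"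
  unfolding payoff_def[abs_def] reward_def[abs_def]
  by (rule needle_family.lipschitz_mab_instance_needles[OF needle_family arms])

lemma bandit_instance_payoff: "bandit_instance M A (reward p L) (payoff p L)"
  by (rule bandit_instance_if_Lipschitz[OF Metric_space_axioms arms algorithm
        lipschitz_mab_instance_payoff])

lemma bandit_run_reward: "bandit_run M A (reward p L)"
  using bandit_instance_payoff by (rule bandit_instance.axioms)

lemma reward_cong: "(\<And>l. l \<in> L \<Longrightarrow> p l = q l) \<Longrightarrow> reward p L = reward q L"
  by (simp add: reward_def[abs_def] payoff_def needles_def cong: image_cong)

lemma sets_tail: "tail k \<in> sets M"
proof -
  have "mball (a i) r \<in> sets M" for i
    using arms openin_mball unfolding arm_space_def by blast
  then show ?thesis by (auto simp: tail_def)
qed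

lemma decseq_tail: "decseq tail"
  unfolding decseq_def tail_def by (intro allI impI UN_mono) auto

lemma Inter_tail: "(\<Inter>k. tail k) = {}"
proof -
  have False if x: "x \<in> (\<Inter>k. tail k)" for x
  proof -
    obtain i where first: "x \<in> mball (a i) r" using x by (auto simp: tail_def)
    obtain j where later: "Suc i \<le> j" "x \<in> mball (a j) r" using x by (auto simp: tail_def)
    show False
      using first later separated[of i j] triangle[of "a i" x "a j"] commute[of x "a j"] by auto
  qed
  then show ?thesis by blast
qed

lemma ex_hidden_placement:
  obtains p where "mono p"
    "\<And>j. 1/2 \<le> measure (history_law M A (reward p {..<j}) (T j)) (avoiding M (tail (p j)) (T j))"
proof -
  let ?hidden = "\<lambda>p j k.
    1/2 \<le> measure (history_law M A (reward p {..<j}) (T j)) (avoiding M (tail k) (T j))"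
  have "\<exists>p. \<forall>j. (\<forall>l<j. p l \<le> p j) \<and> ?hidden p j (p j)"
  proof (rule dependent_wf_choice[OF wf_less_than, where P = "\<lambda>p j k. (\<forall>l<j. p l \<le> k) \<and> ?hidden p j k"])
    fix p q :: "nat \<Rightarrow> nat" and j k assume eq: "\<And>l. (l, j) \<in> less_than \<Longrightarrow> p l = q l"
    then have "reward p {..<j} = reward q {..<j}" by (intro reward_cong) auto
    with eq show "((\<forall>l<j. p l \<le> k) \<and> ?hidden p j k) = ((\<forall>l<j. q l \<le> k) \<and> ?hidden q j k)" by simp
  next
    fix j and p :: "nat \<Rightarrow> nat"
    have "(\<lambda>k. measure (history_law M A (reward p {..<j}) (T j)) (avoiding M (tail k) (T j))) \<longlonglongrightarrow> 1"
      by (rule bandit_run.prob_avoiding_tendsto_1)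
        (rule bandit_run_reward sets_tail decseq_tail Inter_tail)+
    then have "\<forall>\<^sub>F k in sequentially. ?hidden p j k"
      by (rule eventually_mono[OF order_tendstoD(1)[where a = "1/2"]]) auto
    moreover have "\<forall>\<^sub>F k in sequentially. \<forall>l\<in>{..<j}. p l \<le> k"
      by (intro eventually_ball_finite ballI eventually_ge_at_top) simp
    ultimately have "\<forall>\<^sub>F k in sequentially. (\<forall>l<j. p l \<le> k) \<and> ?hidden p j k"
      by eventually_elim simp
    then show "\<exists>k. (\<forall>l<j. p l \<le> k) \<and> ?hidden p j k"
      by (auto simp: eventually_sequentially)
  qed
  then obtain p where placement: "\<And>l j. l < j \<Longrightarrow> p l \<le> p j" "\<And>j. ?hidden p j (p j)" by blast
  show thesis
  proof (rule that[OF _ placement(2)])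
    show "mono p" by (rule monoI) (metis placement(1) order_le_less)
  qed
qed

lemma payoff_off_tail:
  assumes "mono p" and x: "x \<in> X - tail (p j)"
  shows "payoff p UNIV x = payoff p {..<j} x"
  unfolding payoff_def
proof (rule needle_family.needles_eq_if_out_of_reach[OF needle_family])
  fix l assume "l \<in> UNIV - {..<j}"
  then have "x \<notin> mball (a (p l)) r"
    using x monoD[OF assms(1), of j l] by (auto simp: tail_def)
  then have "r \<le> D x (a (p l))"
    using x centers commute[of x] by auto
  then show "height l \<le> D x ((a \<circ> p) l)"
    using height_le[of l] by simp
qed simp

lemma payoff_lessThan_le: "payoff p {..<j} x \<le> r * (1 - (1/2) ^ j)"
  unfolding payoff_def
proof (rule needle_family.needles_least[OF needle_family])
  show "0 \<le> r * (1 - (1/2) ^ j)" using radius by (simp add: power_le_one)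
  fix l assume "l \<in> {..<j}"
  then have "height l \<le> r * (1 - (1/2) ^ j)" by (simp add: height_le_if_less)
  then show "height l - D x ((a \<circ> p) l) \<le> r * (1 - (1/2) ^ j)"
    using nonneg[of x "(a \<circ> p) l"] by linarith
qed

lemma Sup_payoff_ge: "r \<le> (SUP x\<in>X. payoff p UNIV x)"
proof (rule LIMSEQ_le_const2)
  show "height \<longlonglongrightarrow> r"
    unfolding height_def[abs_def] by real_asymp
  have "height l \<le> (SUP x\<in>X. payoff p UNIV x)" for l
  proof -
    have center: "a (p l) \<in> X" using centers by blast
    then have "height l \<le> payoff p UNIV (a (p l))"
      using needle_family.needle_le_needles[OF needle_family, of l UNIV "a (p l)" p]
      by (simp add: payoff_def)
    also have "\<dots> \<le> (SUP x\<in>X. payoff p UNIV x)"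
      using bandit_instance.bdd_above_payoff[OF bandit_instance_payoff] center
      by (intro cSUP_upper) (simp_all add: space_M)
    finally show ?thesis .
  qed
  then show "\<exists>N. \<forall>l\<ge>N. height l \<le> (SUP x\<in>X. payoff p UNIV x)" by blast
qed

lemma regret_payoff_ge:
  assumes "mono p"
    and hidden: "1/2 \<le> measure (history_law M A (reward p {..<j}) t) (avoiding M (tail (p j)) t)"
  shows "real t * (r * (1/2) ^ j) / 2 \<le> regret M A (payoff p UNIV) (reward p UNIV) t"
proof -
  interpret bandit_instance M A "reward p UNIV" "payoff p UNIV" by (rule bandit_instance_payoff)
  have off_tail: "payoff p UNIV x = payoff p {..<j} x" if "x \<in> space M - tail (p j)" for x
    using payoff_off_tail[OF assms(1)] that by (simp add: space_M)
  have "r * (1/2) ^ j \<le> gap x" if "x \<in> space M - tail (p j)" for x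
    using payoff_lessThan_le[of p j x] Sup_payoff_ge[of p]
    by (simp add: gap_def space_M off_tail[OF that] right_diff_distrib)
  then have "real t * (r * (1/2) ^ j) * measure (law t) (avoiding M (tail (p j)) t)
      \<le> regret M A (payoff p UNIV) (reward p UNIV) t"
    by (intro regret_ge_avoiding sets_tail)
  moreover have "1/2 \<le> measure (law t) (avoiding M (tail (p j)) t)"
    using hidden prob_avoiding_cong[OF bandit_run_reward bandit_run_reward sets_tail]
    by (metis off_tail reward_def)
  then have "real t * (r * (1/2) ^ j) * (1/2) \<le>
      real t * (r * (1/2) ^ j) * measure (law t) (avoiding M (tail (p j)) t)"
    using radius by (intro mult_left_mono) auto
  ultimately show ?thesis by simp
qed

lemma ex_hard_instance:
  fixes T :: "nat \<Rightarrow> nat"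
  obtains \<mu> \<nu> where "lipschitz_mab_instance X D M \<mu> \<nu>"
    "\<And>j. real (T j) * (r * (1/2) ^ j) / 2 \<le> regret M A \<mu> \<nu> (T j)"
  using ex_hidden_placement[of T] lipschitz_mab_instance_payoff regret_payoff_ge by metis

end

section \<open>Tractability\<close>

lemma slow_level_if_eventually:
  fixes P :: "nat \<Rightarrow> nat \<Rightarrow> bool"
  assumes "\<And>k. eventually (P k) sequentially"
  obtains l :: "nat \<Rightarrow> nat" where "filterlim l at_top sequentially" "\<And>t. l t = 0 \<or> P (l t) t"
proof
  define levels where "levels t = {k. k \<le> t \<and> (k = 0 \<or> P k t)}" for t
  have finite: "finite (levels t)" for t
    by (rule finite_subset[of _ "{..t}"]) (auto simp: levels_def)
  have "Max (levels t) \<in> levels t" for t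
    using finite by (intro Max_in) (auto simp: levels_def)
  then show "Max (levels t) = 0 \<or> P (Max (levels t)) t" for t
    by (auto simp: levels_def)
  show "filterlim (\<lambda>t. Max (levels t)) at_top sequentially"
    unfolding filterlim_at_top
  proof
    fix k
    show "\<forall>\<^sub>F t in sequentially. k \<le> Max (levels t)"
      using assms[of k] eventually_ge_at_top[of k]
      by eventually_elim (auto simp: levels_def intro!: Max_ge finite[unfolded levels_def])
  qed
qed

lemma tractable_explore_exploit:
  assumes "Metric_space X D" and arms: "arm_space X D M" and sequence_in: "range a \<subseteq> X"
    and \<epsilon>_pos: "\<And>t. 0 < \<epsilon> t"
    and accuracy: "\<And>t. 1 \<le> \<epsilon> t \<or>
      (\<forall>y\<in>X. \<exists>i<n t. D y (a i) < \<epsilon> t) \<and>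
      (\<forall>i<n t. (real (n t) / \<epsilon> t)\<^sup>2 \<le> card (exploration_rounds i t))"
  shows "tractable X D M (explore_exploit_rate \<epsilon>)"
proof -
  let ?A = "\<lambda>t h. return M (explore_exploit_arm a n t h)"
  have space_M: "space M = X" using arms by (simp add: arm_space_def)
  have algorithm: "bandit_algorithm M ?A"
    using sequence_in by (intro bandit_algorithm_explore_exploit) (simp add: space_M)
  have "regret M ?A \<mu> \<nu> t \<le> explore_exploit_rate \<epsilon> t"
    if inst: "lipschitz_mab_instance X D M \<mu> \<nu>" for \<mu> \<nu> t
  proof -
    interpret explore_exploit M a n \<nu> \<mu>
      using bandit_instance_if_Lipschitz[OF assms(1) arms algorithm inst] sequence_in
      by (simp add: explore_exploit_def explore_exploit_axioms_def space_M)
    have payoff_le: "\<mu> y \<le> \<mu> (a i) + \<epsilon> s" if "y \<in> X" "D y (a i) < \<epsilon> s" for y i s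
    proof -
      have "\<bar>\<mu> y - \<mu> (a i)\<bar> \<le> D y (a i)"
        using inst that(1) sequence_in by (auto simp: lipschitz_mab_instance_def)
      with that(2) show ?thesis by simp
    qed
    show ?thesis
    proof (rule regret_le_explore_exploit_rate[OF \<epsilon>_pos])
      show "1 \<le> \<epsilon> s \<or> (\<forall>y\<in>space M. \<exists>i<n s. \<mu> y \<le> \<mu> (a i) + \<epsilon> s) \<and>
          (\<forall>i<n s. (real (n s) / \<epsilon> s)\<^sup>2 \<le> card (exploration_rounds i s))" for s
        using accuracy[of s] payoff_le unfolding space_M by meson
    qed
  qed
  then show ?thesis
    unfolding tractable_def using algorithm by (metis mult_1)
qed

lemma tractable_if_mtotally_bounded:
  assumes "Metric_space X D" "X \<noteq> {}" and arms: "arm_space X D M"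
    and "Metric_space.mtotally_bounded X D X"
  obtains f :: "nat \<Rightarrow> real" where "(\<lambda>t. f t / real t) \<longlonglongrightarrow> 0" "tractable X D M f"
proof -
  interpret Metric_space X D by fact
  obtain a :: "nat \<Rightarrow> 'a" and N where candidates: "range a \<subseteq> X"
    and net: "\<And>k y. y \<in> X \<Longrightarrow> \<exists>i<N k. D y (a i) < 1 / real (Suc k)"
    using net_sequence_if_mtotally_bounded[OF assms(4,2)] by blast
  define explored where
    "explored k t \<longleftrightarrow> (\<forall>i<N k. (N k * Suc k)\<^sup>2 \<le> card (exploration_rounds i t))" for k t
  have "\<forall>\<^sub>F t in sequentially. \<forall>i\<in>{..<N k}. (N k * Suc k)\<^sup>2 \<le> card (exploration_rounds i t)" for k
    using card_exploration_rounds_at_top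
    by (intro eventually_ball_finite) (auto simp: filterlim_at_top)
  then have "eventually (explored k) sequentially" for k
    by (simp add: explored_def[abs_def] Ball_def)
  then obtain level where level: "filterlim level at_top sequentially"
      "\<And>t. level t = 0 \<or> explored (level t) t"
    using slow_level_if_eventually[of explored] by blast
  define \<epsilon> where "\<epsilon> t = 1 / real (Suc (level t))" for t
  have "tractable X D M (explore_exploit_rate \<epsilon>)"
  proof (rule tractable_explore_exploit[where n = "\<lambda>t. N (level t)", OF assms(1) arms candidates])
    show "0 < \<epsilon> t" for t by (simp add: \<epsilon>_def)
    have "(real (N (level t)) / \<epsilon> t)\<^sup>2 \<le> card (exploration_rounds i t)"
      if "explored (level t) t" "i < N (level t)" for t i
    proof -
      have "real ((N (level t) * Suc (level t))\<^sup>2) \<le> card (exploration_rounds i t)"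
        using that by (simp only: explored_def of_nat_le_iff)
      then show ?thesis by (simp add: \<epsilon>_def distrib_left)
    qed
    then show "1 \<le> \<epsilon> t \<or> (\<forall>y\<in>X. \<exists>i<N (level t). D y (a i) < \<epsilon> t) \<and>
        (\<forall>i<N (level t). (real (N (level t)) / \<epsilon> t)\<^sup>2 \<le> card (exploration_rounds i t))" for t
      using level(2)[of t] net by (auto simp: \<epsilon>_def)
  qed
  moreover have "\<epsilon> \<longlonglongrightarrow> 0"
    unfolding \<epsilon>_def by (rule filterlim_compose[OF _ level(1)]) real_asymp
  then have "(\<lambda>t. explore_exploit_rate \<epsilon> t / real t) \<longlonglongrightarrow> 0"
    by (rule explore_exploit_rate_sublinear)
  ultimately show thesis by (rule that[rotated])
qed

lemma small_times_if_sublinear: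
  fixes f \<delta> :: "nat \<Rightarrow> real"
  assumes sublinear: "(\<lambda>t. f t / real t) \<longlonglongrightarrow> 0" and \<delta>_pos: "\<And>j. 0 < \<delta> j"
  obtains T :: "nat \<Rightarrow> nat" where "\<And>j. 1 \<le> T j" "\<And>j. \<bar>f (T j)\<bar> \<le> real (T j) * \<delta> j"
proof -
  have "\<exists>t\<ge>1. \<bar>f t\<bar> \<le> real t * \<delta> j" for j
  proof -
    have "\<forall>\<^sub>F t in sequentially. \<bar>f t / real t\<bar> < \<delta> j"
      using order_tendstoD(2)[OF tendsto_rabs_zero[OF sublinear]] \<delta>_pos by simp
    then have "\<forall>\<^sub>F t in sequentially. 1 \<le> t \<and> \<bar>f t\<bar> \<le> real t * \<delta> j"
      using eventually_ge_at_top[of 1] by eventually_elim (simp add: abs_divide field_simps)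
    then show ?thesis
      by (auto simp: eventually_sequentially)
  qed
  then show thesis using that by metis
qed

lemma not_tractable_if_separated:
  fixes a :: "nat \<Rightarrow> 'a"
  assumes "Metric_space X D" and arms: "arm_space X D M"
    and "e > 0" and centers: "range a \<subseteq> X" and separated: "\<And>i j. i \<noteq> j \<Longrightarrow> e \<le> D (a i) (a j)"
    and sublinear: "(\<lambda>t. f t / real t) \<longlonglongrightarrow> 0"
  shows "\<not> tractable X D M f"
proof
  assume "tractable X D M f"
  then obtain A where algorithm: "bandit_algorithm M A"
    and bound: "\<And>\<mu> \<nu>. lipschitz_mab_instance X D M \<mu> \<nu> \<Longrightarrow> \<exists>C. \<forall>t\<ge>1. regret M A \<mu> \<nu> t \<le> C * f t"
    unfolding tractable_def by blast
  define r where "r = min (e / 2) 1"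
  have r_bounds: "0 < r" "r \<le> 1" "2 * r \<le> e" using \<open>e > 0\<close> by (auto simp: r_def)
  interpret hidden_needles X D M A a r
    using assms(1) arms algorithm centers r_bounds separated
    by (auto simp: hidden_needles_def hidden_needles_axioms_def intro: order_trans)
  define \<delta> where "\<delta> j = r * (1/2) ^ j" for j :: nat
  have \<delta>_pos: "0 < \<delta> j" for j using r_bounds by (simp add: \<delta>_def)
  then obtain T where times: "\<And>j. 1 \<le> T j" "\<And>j. \<bar>f (T j)\<bar> \<le> real (T j) * (\<delta> j / real (Suc j))"
    using small_times_if_sublinear[OF sublinear, of "\<lambda>j. \<delta> j / real (Suc j)"] by auto
  obtain \<mu> \<nu> where "lipschitz_mab_instance X D M \<mu> \<nu>"
    and hard: "\<And>j. real (T j) * \<delta> j / 2 \<le> regret M A \<mu> \<nu> (T j)"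
    using ex_hard_instance[of T] unfolding \<delta>_def by blast
  then obtain C where regret_le: "\<And>t. 1 \<le> t \<Longrightarrow> regret M A \<mu> \<nu> t \<le> C * f t"
    using bound by blast
  obtain j where j_large: "2 * \<bar>C\<bar> < real j" using reals_Archimedean2 by blast
  have "real (T j) * \<delta> j / 2 \<le> C * f (T j)" using hard regret_le[OF times(1)] by (rule order_trans)
  also have "\<dots> \<le> \<bar>C\<bar> * \<bar>f (T j)\<bar>" using abs_ge_self[of "C * f (T j)"] by (simp add: abs_mult)
  also have "\<dots> \<le> \<bar>C\<bar> * (real (T j) * (\<delta> j / real (Suc j)))" using times(2) by (rule mult_left_mono) simp
  finally have "real (T j) * \<delta> j * real (Suc j) \<le> real (T j) * \<delta> j * (2 * \<bar>C\<bar>)"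
    by (simp add: field_simps)
  moreover have "0 < real (T j) * \<delta> j" using \<delta>_pos times(1)[of j] by simp
  ultimately have "real (Suc j) \<le> 2 * \<bar>C\<bar>" by (simp only: mult_le_cancel_left_pos)
  with j_large show False by simp
qed

theorem theorem1p8:
  fixes X :: "'a set" and D :: "'a \<Rightarrow> 'a \<Rightarrow> real" and M :: "'a measure"
  assumes "Metric_space X D" and "X \<noteq> {}"
    and "\<And>x y. x \<in> X \<Longrightarrow> y \<in> X \<Longrightarrow> D x y \<le> 1"
    and "arm_space X D M"
  shows "(\<exists>f :: nat \<Rightarrow> real. (\<lambda>t. f t / real t) \<longlonglongrightarrow> 0 \<and> tractable X D M f) \<longleftrightarrow>
    compact_space (Metric_space.mtopology (completion_space X D) (completion_dist X D))"
proof -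
  interpret Metric_space X D by fact
  have "mtotally_bounded X" if f: "(\<lambda>t. f t / real t) \<longlonglongrightarrow> 0" "tractable X D M f" for f
  proof (rule ccontr)
    assume "\<not> mtotally_bounded X"
    then obtain e and a :: "nat \<Rightarrow> 'a"
      where "e > 0" "range a \<subseteq> X" "\<And>i j. i \<noteq> j \<Longrightarrow> e \<le> D (a i) (a j)"
      using separated_sequence_if_not_mtotally_bounded by blast
    from not_tractable_if_separated[OF assms(1,4) this f(1)] f(2) show False by blast
  qed
  moreover have "\<exists>f. (\<lambda>t. f t / real t) \<longlonglongrightarrow> 0 \<and> tractable X D M f" if "mtotally_bounded X"
    using tractable_if_mtotally_bounded[OF assms(1,2,4) that] by blast
  ultimately show ?thesis
    unfolding compact_completion_iff_mtotally_bounded by blast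
qed

end
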